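(* Let $\mathcal{M}$ be a right proper closed model category for which the class of weak equivalences is closed under finite products. Then for all objects $X$ and $Y$ of $\mathcal{M}$ the function $$\phi: \pi_{0}H(X,Y) \to [X,Y], \qquad [(f,g)] \mapsto g\cdot f^{-1},$$ is a bijection.
   Context: A closed model category here is a category with all finite limits and colimits and with classes of weak equivalences, fibrations and cofibrations satisfying Quillen's axioms CM1--CM5 (two out of three, retracts, lifting, and factorization of any map as a cofibration followed by a trivial fibration and as a trivial cofibration followed by a fibration). It is right proper if weak equivalences are closed under pullback along fibrations. Weak equivalences are closed under finite products if, whenever $f: X \to Y$ is a weak equivalence and $Z$ is an object, the map $f\times 1: X \times Z \to Y \times Z$ is a weak equivalence. For objects $X,Y$ of $\mathcal{M}$, the category of cocycles $H(X,Y)$ has as objects all pairs of maps $(f,g)$, $X \xleftarrow{f} Z \xrightarrow{g} Y$ (with $Z$ an arbitrary object of $\mathcal{M}$), such that $f$ is a weak equivalence. A morphism $\alpha: (f,g) \to (f',g')$, where $X \xleftarrow{f'} Z' \xrightarrow{g'} Y$, is a map $\alpha: Z \to Z'$ of $\mathcal{M}$ with $f'\alpha = f$ and $g'\alpha = g$. $\pi_{0}H(X,Y)$ is the class of path components of $H(X,Y)$ (objects modulo the equivalence relation generated by the existence of a morphism). $[X,Y]$ is the set of morphisms from $X$ to $Y$ in the homotopy category $\operatorname{Ho}(\mathcal{M})$, obtained from $\mathcal{M}$ by formally inverting the weak equivalences; $g\cdot f^{-1}$ is computed in $\operatorname{Ho}(\mathcal{M})$. *)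

theory Defs
  imports Main
begin

section \<open>Categories\<close>

record ('o, 'm) category =
  Ob :: "'o set"
  Ar :: "'m set"
  Dom :: "'m \<Rightarrow> 'o"
  Cod :: "'m \<Rightarrow> 'o"
  Idt :: "'o \<Rightarrow> 'm"
  Cmp :: "'m \<Rightarrow> 'm \<Rightarrow> 'm"  (infixl \<open>\<cdot>\<index>\<close> 70)

definition hom :: "('o, 'm) category \<Rightarrow> 'o \<Rightarrow> 'o \<Rightarrow> 'm set" where
  "hom C X Y = {f \<in> Ar C. Dom C f = X \<and> Cod C f = Y}"

locale category =
  fixes C :: "('o, 'm) category" (structure)
  assumes Dom_in: "f \<in> Ar C \<Longrightarrow> Dom C f \<in> Ob C"
    and Cod_in: "f \<in> Ar C \<Longrightarrow> Cod C f \<in> Ob C"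
    and Idt_hom: "X \<in> Ob C \<Longrightarrow> Idt C X \<in> hom C X X"
    and Cmp_hom: "\<lbrakk>f \<in> hom C X Y; g \<in> hom C Y Z\<rbrakk> \<Longrightarrow> g \<cdot> f \<in> hom C X Z"
    and Cmp_assoc: "\<lbrakk>f \<in> hom C X Y; g \<in> hom C Y Z; h \<in> hom C Z T\<rbrakk>
        \<Longrightarrow> h \<cdot> (g \<cdot> f) = (h \<cdot> g) \<cdot> f"
    and Idt_right: "f \<in> hom C X Y \<Longrightarrow> f \<cdot> Idt C X = f"
    and Idt_left: "f \<in> hom C X Y \<Longrightarrow> Idt C Y \<cdot> f = f"

definition opposite :: "('o, 'm) category \<Rightarrow> ('o, 'm) category" where
  "opposite C = \<lparr>Ob = Ob C, Ar = Ar C, Dom = Cod C, Cod = Dom C, Idt = Idt C,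
                 Cmp = (\<lambda>g f. f \<cdot>\<^bsub>C\<^esub> g)\<rparr>"

definition inverse_arrows :: "('o, 'm) category \<Rightarrow> 'm \<Rightarrow> 'm \<Rightarrow> bool" where
  "inverse_arrows C f g \<longleftrightarrow>
     f \<in> Ar C \<and> g \<in> hom C (Cod C f) (Dom C f) \<and>
     g \<cdot>\<^bsub>C\<^esub> f = Idt C (Dom C f) \<and> f \<cdot>\<^bsub>C\<^esub> g = Idt C (Cod C f)"

definition is_iso :: "('o, 'm) category \<Rightarrow> 'm \<Rightarrow> bool" where
  "is_iso C f \<longleftrightarrow> (\<exists>g. inverse_arrows C f g)"

definition inverse_arrow :: "('o, 'm) category \<Rightarrow> 'm \<Rightarrow> 'm" where
  "inverse_arrow C f = (THE g. inverse_arrows C f g)"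

definition is_functor ::
  "('o, 'm) category \<Rightarrow> ('p, 'n) category \<Rightarrow> ('o \<Rightarrow> 'p) \<Rightarrow> ('m \<Rightarrow> 'n) \<Rightarrow> bool" where
  "is_functor C D Fo Fm \<longleftrightarrow>
     (\<forall>X\<in>Ob C. Fo X \<in> Ob D \<and> Fm (Idt C X) = Idt D (Fo X)) \<and>
     (\<forall>f\<in>Ar C. Fm f \<in> hom D (Fo (Dom C f)) (Fo (Cod C f))) \<and>
     (\<forall>f\<in>Ar C. \<forall>g\<in>Ar C. Cod C f = Dom C g \<longrightarrow> Fm (g \<cdot>\<^bsub>C\<^esub> f) = Fm g \<cdot>\<^bsub>D\<^esub> Fm f)"


section \<open>Limits\<close>

definition is_cone ::
  "('i, 'j) category \<Rightarrow> ('o, 'm) category \<Rightarrow> ('i \<Rightarrow> 'o) \<Rightarrow> ('j \<Rightarrow> 'm) \<Rightarrow> 'o \<Rightarrow> ('i \<Rightarrow> 'm) \<Rightarrow> bool" where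
  "is_cone J C Fo Fm L leg \<longleftrightarrow>
     L \<in> Ob C \<and> (\<forall>i\<in>Ob J. leg i \<in> hom C L (Fo i)) \<and>
     (\<forall>u\<in>Ar J. Fm u \<cdot>\<^bsub>C\<^esub> leg (Dom J u) = leg (Cod J u))"

definition is_limit ::
  "('i, 'j) category \<Rightarrow> ('o, 'm) category \<Rightarrow> ('i \<Rightarrow> 'o) \<Rightarrow> ('j \<Rightarrow> 'm) \<Rightarrow> 'o \<Rightarrow> ('i \<Rightarrow> 'm) \<Rightarrow> bool" where
  "is_limit J C Fo Fm L leg \<longleftrightarrow>
     is_cone J C Fo Fm L leg \<and>
     (\<forall>N k. is_cone J C Fo Fm N k \<longrightarrow>
        (\<exists>!h. h \<in> hom C N L \<and> (\<forall>i\<in>Ob J. leg i \<cdot>\<^bsub>C\<^esub> h = k i)))"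

text \<open>Every finite category is isomorphic to one whose objects and arrows are natural numbers, so
  letting the index category range over finite categories of this type loses nothing.\<close>

definition has_finite_limits :: "('o, 'm) category \<Rightarrow> bool" where
  "has_finite_limits C \<longleftrightarrow>
     (\<forall>(J :: (nat, nat) category) Fo Fm.
        category J \<and> finite (Ob J) \<and> finite (Ar J) \<and> is_functor J C Fo Fm \<longrightarrow>
        (\<exists>L leg. is_limit J C Fo Fm L leg))"

definition has_finite_colimits :: "('o, 'm) category \<Rightarrow> bool" where
  "has_finite_colimits C \<longleftrightarrow> has_finite_limits (opposite C)"

definition is_product ::
  "('o, 'm) category \<Rightarrow> 'o \<Rightarrow> 'o \<Rightarrow> 'o \<Rightarrow> 'm \<Rightarrow> 'm \<Rightarrow> bool" where
  "is_product C X Y P p q \<longleftrightarrow>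
     p \<in> hom C P X \<and> q \<in> hom C P Y \<and>
     (\<forall>N a b. a \<in> hom C N X \<and> b \<in> hom C N Y \<longrightarrow>
        (\<exists>!h. h \<in> hom C N P \<and> p \<cdot>\<^bsub>C\<^esub> h = a \<and> q \<cdot>\<^bsub>C\<^esub> h = b))"

text \<open>\<open>is_pullback C f g p q\<close>: the arrows \<open>p\<close> and \<open>q\<close> form a pullback of the cospan
  \<open>f\<close>, \<open>g\<close>, in a square with \<open>f \<cdot> p = g \<cdot> q\<close>; so \<open>q\<close> is the pullback of \<open>f\<close> along \<open>g\<close>.\<close>

definition is_pullback :: "('o, 'm) category \<Rightarrow> 'm \<Rightarrow> 'm \<Rightarrow> 'm \<Rightarrow> 'm \<Rightarrow> bool" where
  "is_pullback C f g p q \<longleftrightarrow>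
     f \<in> Ar C \<and> g \<in> Ar C \<and> Cod C f = Cod C g \<and>
     p \<in> hom C (Dom C p) (Dom C f) \<and> q \<in> hom C (Dom C p) (Dom C g) \<and>
     f \<cdot>\<^bsub>C\<^esub> p = g \<cdot>\<^bsub>C\<^esub> q \<and>
     (\<forall>N a b. a \<in> hom C N (Dom C f) \<and> b \<in> hom C N (Dom C g) \<and> f \<cdot>\<^bsub>C\<^esub> a = g \<cdot>\<^bsub>C\<^esub> b \<longrightarrow>
        (\<exists>!h. h \<in> hom C N (Dom C p) \<and> p \<cdot>\<^bsub>C\<^esub> h = a \<and> q \<cdot>\<^bsub>C\<^esub> h = b))"


section \<open>Closed model categories\<close>

definition is_retract :: "('o, 'm) category \<Rightarrow> 'm \<Rightarrow> 'm \<Rightarrow> bool" where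
  "is_retract C f g \<longleftrightarrow>
     f \<in> Ar C \<and> g \<in> Ar C \<and>
     (\<exists>i\<in>hom C (Dom C f) (Dom C g). \<exists>r\<in>hom C (Dom C g) (Dom C f).
      \<exists>j\<in>hom C (Cod C f) (Cod C g). \<exists>s\<in>hom C (Cod C g) (Cod C f).
        r \<cdot>\<^bsub>C\<^esub> i = Idt C (Dom C f) \<and> s \<cdot>\<^bsub>C\<^esub> j = Idt C (Cod C f) \<and>
        g \<cdot>\<^bsub>C\<^esub> i = j \<cdot>\<^bsub>C\<^esub> f \<and> f \<cdot>\<^bsub>C\<^esub> r = s \<cdot>\<^bsub>C\<^esub> g)"

definition retract_closed :: "('o, 'm) category \<Rightarrow> 'm set \<Rightarrow> bool" where
  "retract_closed C S \<longleftrightarrow> (\<forall>f g. is_retract C f g \<and> g \<in> S \<longrightarrow> f \<in> S)"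

definition two_out_of_three :: "('o, 'm) category \<Rightarrow> 'm set \<Rightarrow> bool" where
  "two_out_of_three C S \<longleftrightarrow>
     (\<forall>f\<in>Ar C. \<forall>g\<in>Ar C. Cod C f = Dom C g \<longrightarrow>
        (f \<in> S \<and> g \<in> S \<longrightarrow> g \<cdot>\<^bsub>C\<^esub> f \<in> S) \<and>
        (f \<in> S \<and> g \<cdot>\<^bsub>C\<^esub> f \<in> S \<longrightarrow> g \<in> S) \<and>
        (g \<in> S \<and> g \<cdot>\<^bsub>C\<^esub> f \<in> S \<longrightarrow> f \<in> S))"

definition has_lifting :: "('o, 'm) category \<Rightarrow> 'm \<Rightarrow> 'm \<Rightarrow> bool" where
  "has_lifting C i p \<longleftrightarrow>
     (\<forall>u\<in>hom C (Dom C i) (Dom C p). \<forall>v\<in>hom C (Cod C i) (Cod C p).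
        p \<cdot>\<^bsub>C\<^esub> u = v \<cdot>\<^bsub>C\<^esub> i \<longrightarrow>
        (\<exists>h\<in>hom C (Cod C i) (Dom C p). h \<cdot>\<^bsub>C\<^esub> i = u \<and> p \<cdot>\<^bsub>C\<^esub> h = v))"

definition has_factorization :: "('o, 'm) category \<Rightarrow> 'm set \<Rightarrow> 'm set \<Rightarrow> bool" where
  "has_factorization C L R \<longleftrightarrow>
     (\<forall>f\<in>Ar C. \<exists>i\<in>L. \<exists>p\<in>R. Cod C i = Dom C p \<and> f = p \<cdot>\<^bsub>C\<^esub> i)"

locale closed_model_category = category M
  for M :: "('o, 'm) category" (structure) +
  fixes W Fib Cof :: "'m set"
  assumes W_Ar: "W \<subseteq> Ar M" and Fib_Ar: "Fib \<subseteq> Ar M" and Cof_Ar: "Cof \<subseteq> Ar M"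
    and CM1: "has_finite_limits M" "has_finite_colimits M"
    and CM2: "two_out_of_three M W"
    and CM3: "retract_closed M W" "retract_closed M Fib" "retract_closed M Cof"
    and CM4: "\<lbrakk>i \<in> Cof; p \<in> Fib; i \<in> W \<or> p \<in> W\<rbrakk> \<Longrightarrow> has_lifting M i p"
    and CM5: "has_factorization M Cof (Fib \<inter> W)" "has_factorization M (Cof \<inter> W) Fib"

definition right_proper :: "('o, 'm) category \<Rightarrow> 'm set \<Rightarrow> 'm set \<Rightarrow> bool" where
  "right_proper M W Fib \<longleftrightarrow>
     (\<forall>w\<in>W. \<forall>p\<in>Fib. \<forall>p' w'. is_pullback M w p p' w' \<longrightarrow> w' \<in> W)"

text \<open>Products are not chosen: \<open>h\<close> is the map \<open>f \<times> 1\<close> with respect to any products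
  \<open>P\<close> of \<open>X, Z\<close> and \<open>Q\<close> of \<open>Y, Z\<close>.\<close>

definition closed_under_finite_products :: "('o, 'm) category \<Rightarrow> 'm set \<Rightarrow> bool" where
  "closed_under_finite_products M W \<longleftrightarrow>
     (\<forall>X Y Z f P p q Q p' q' h.
        f \<in> W \<and> f \<in> hom M X Y \<and> is_product M X Z P p q \<and> is_product M Y Z Q p' q' \<and>
        h \<in> hom M P Q \<and> p' \<cdot>\<^bsub>M\<^esub> h = f \<cdot>\<^bsub>M\<^esub> p \<and> q' \<cdot>\<^bsub>M\<^esub> h = q \<longrightarrow> h \<in> W)"


section \<open>Path components\<close>

text \<open>The equivalence relation on \<open>A\<close> generated by the restriction of \<open>R\<close> to \<open>A\<close>.\<close>

definition gen_equiv :: "'a set \<Rightarrow> ('a \<times> 'a) set \<Rightarrow> ('a \<times> 'a) set" where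
  "gen_equiv A R = ((R \<union> R\<inverse>) \<inter> A \<times> A)\<^sup>* \<inter> A \<times> A"

definition connected_rel :: "('o, 'm) category \<Rightarrow> ('o \<times> 'o) set" where
  "connected_rel C = gen_equiv (Ob C) {(X, Y). hom C X Y \<noteq> {}}"

definition path_component :: "('o, 'm) category \<Rightarrow> 'o \<Rightarrow> 'o set" where
  "path_component C X = connected_rel C `` {X}"

definition pi0 :: "('o, 'm) category \<Rightarrow> 'o set set" where
  "pi0 C = Ob C // connected_rel C"

lemma equiv_gen_equiv: "equiv A (gen_equiv A R)"
proof (rule equivI)
  show "gen_equiv A R \<subseteq> A \<times> A" by (auto simp: gen_equiv_def)
  show "refl_on A (gen_equiv A R)" by (auto simp: gen_equiv_def refl_on_def)
  have "sym (((R \<union> R\<inverse>) \<inter> A \<times> A)\<^sup>*)"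
    by (rule sym_rtrancl) (auto simp: sym_def)
  then show "sym (gen_equiv A R)" by (auto simp: gen_equiv_def sym_def)
  show "trans (gen_equiv A R)"
    unfolding gen_equiv_def trans_def by (blast intro: rtrancl_trans)
qed

lemma gen_equiv_induct [consumes 1, case_names rel refl sym trans]:
  assumes "(x, y) \<in> gen_equiv A R"
    and "\<And>x y. \<lbrakk>x \<in> A; y \<in> A; (x, y) \<in> R\<rbrakk> \<Longrightarrow> P x y"
    and "\<And>x. x \<in> A \<Longrightarrow> P x x"
    and "\<And>x y. P x y \<Longrightarrow> P y x"
    and "\<And>x y z. \<lbrakk>P x y; P y z\<rbrakk> \<Longrightarrow> P x z"
  shows "P x y"
proof -
  have "(x, y) \<in> ((R \<union> R\<inverse>) \<inter> A \<times> A)\<^sup>*" and x: "x \<in> A"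
    using assms(1) by (auto simp: gen_equiv_def)
  from this(1) show ?thesis
  proof (induction rule: rtrancl_induct)
    case base
    then show ?case using x assms(3) by blast
  next
    case (step y z)
    then have "P y z" using assms(2,4) by blast
    then show ?case using step assms(5) by blast
  qed
qed

lemma gen_equiv_base: "\<lbrakk>x \<in> A; y \<in> A; (x, y) \<in> R\<rbrakk> \<Longrightarrow> (x, y) \<in> gen_equiv A R"
  by (auto simp: gen_equiv_def)


section \<open>The category of cocycles\<close>

text \<open>An object is a pair \<open>(f, g)\<close> of arrows with a common domain.  A morphism \<open>\<alpha>\<close> is stored
  together with its source and target.\<close>

definition cocycles ::
  "('o, 'm) category \<Rightarrow> 'm set \<Rightarrow> 'o \<Rightarrow> 'o \<Rightarrow> ('m \<times> 'm, ('m \<times> 'm) \<times> 'm \<times> ('m \<times> 'm)) category" where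
  "cocycles M W X Y =
     (let obs = {(f, g). \<exists>Z. f \<in> hom M Z X \<and> g \<in> hom M Z Y \<and> f \<in> W} in
      \<lparr>Ob = obs,
       Ar = {((f, g), \<alpha>, (f', g')) | f g \<alpha> f' g'.
               (f, g) \<in> obs \<and> (f', g') \<in> obs \<and> \<alpha> \<in> hom M (Dom M f) (Dom M f') \<and>
               f' \<cdot>\<^bsub>M\<^esub> \<alpha> = f \<and> g' \<cdot>\<^bsub>M\<^esub> \<alpha> = g},
       Dom = (\<lambda>(c, \<alpha>, c'). c),
       Cod = (\<lambda>(c, \<alpha>, c'). c'),
       Idt = (\<lambda>(f, g). ((f, g), Idt M (Dom M f), (f, g))),
       Cmp = (\<lambda>(c', \<beta>, c'') (c, \<alpha>, d). (c, \<beta> \<cdot>\<^bsub>M\<^esub> \<alpha>, c''))\<rparr>)"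


section \<open>Localization\<close>

text \<open>The category obtained from \<open>C\<close> by formally inverting the arrows in \<open>W\<close>: its arrows are
  words in the arrows of \<open>C\<close> and formal inverses of the arrows in \<open>W\<close>, modulo the congruence
  generated by the evident relations.  Words are read in diagrammatic order, the leftmost letter
  being the first to be applied.  The universal property is \<open>localization_extension\<close> and
  \<open>localization_extension_unique\<close> below.\<close>

datatype 'm letter = Fwd 'm | Bwd 'm

fun letter_src :: "('o, 'm) category \<Rightarrow> 'm letter \<Rightarrow> 'o" where
  "letter_src C (Fwd f) = Dom C f"
| "letter_src C (Bwd w) = Cod C w"

fun letter_tgt :: "('o, 'm) category \<Rightarrow> 'm letter \<Rightarrow> 'o" where
  "letter_tgt C (Fwd f) = Cod C f"
| "letter_tgt C (Bwd w) = Dom C w"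

definition letters :: "('o, 'm) category \<Rightarrow> 'm set \<Rightarrow> 'm letter set" where
  "letters C W = Fwd ` Ar C \<union> Bwd ` (W \<inter> Ar C)"

fun is_word :: "('o, 'm) category \<Rightarrow> 'm set \<Rightarrow> 'o \<Rightarrow> 'm letter list \<Rightarrow> 'o \<Rightarrow> bool" where
  "is_word C W X [] Y \<longleftrightarrow> X \<in> Ob C \<and> Y = X"
| "is_word C W X (s # ss) Y \<longleftrightarrow>
     s \<in> letters C W \<and> letter_src C s = X \<and> is_word C W (letter_tgt C s) ss Y"

definition words :: "('o, 'm) category \<Rightarrow> 'm set \<Rightarrow> 'o \<Rightarrow> 'o \<Rightarrow> 'm letter list set" where
  "words C W X Y = {u. is_word C W X u Y}"

inductive basic_rel ::
  "('o, 'm) category \<Rightarrow> 'm set \<Rightarrow> 'm letter list \<Rightarrow> 'm letter list \<Rightarrow> bool"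
  for C :: "('o, 'm) category" and W :: "'m set" where
  comp: "\<lbrakk>f \<in> Ar C; g \<in> Ar C; Cod C f = Dom C g\<rbrakk>
           \<Longrightarrow> basic_rel C W [Fwd f, Fwd g] [Fwd (g \<cdot>\<^bsub>C\<^esub> f)]"
| idt: "X \<in> Ob C \<Longrightarrow> basic_rel C W [Fwd (Idt C X)] []"
| right_inv: "w \<in> W \<inter> Ar C \<Longrightarrow> basic_rel C W [Fwd w, Bwd w] []"
| left_inv: "w \<in> W \<inter> Ar C \<Longrightarrow> basic_rel C W [Bwd w, Fwd w] []"

definition word_equiv ::
  "('o, 'm) category \<Rightarrow> 'm set \<Rightarrow> 'o \<Rightarrow> 'o \<Rightarrow> ('m letter list \<times> 'm letter list) set" where
  "word_equiv C W X Y =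
     gen_equiv (words C W X Y) {(p @ a @ q, p @ b @ q) | p a b q. basic_rel C W a b}"

type_synonym ('o, 'm) loc_arrow = "'o \<times> 'm letter list set \<times> 'o"

definition word_class ::
  "('o, 'm) category \<Rightarrow> 'm set \<Rightarrow> 'o \<Rightarrow> 'm letter list \<Rightarrow> 'o \<Rightarrow> ('o, 'm) loc_arrow" where
  "word_class C W X u Y = (X, word_equiv C W X Y `` {u}, Y)"

definition localization ::
  "('o, 'm) category \<Rightarrow> 'm set \<Rightarrow> ('o, ('o, 'm) loc_arrow) category" where
  "localization C W =
     \<lparr>Ob = Ob C,
      Ar = {(X, c, Y). X \<in> Ob C \<and> Y \<in> Ob C \<and> c \<in> words C W X Y // word_equiv C W X Y},
      Dom = (\<lambda>(X, c, Y). X),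
      Cod = (\<lambda>(X, c, Y). Y),
      Idt = (\<lambda>X. word_class C W X [] X),
      Cmp = (\<lambda>(Y', d, Z) (X, c, Y). (X, \<Union>u\<in>c. \<Union>v\<in>d. word_equiv C W X Z `` {u @ v}, Z))\<rparr>"

text \<open>The localization functor is the identity on objects and \<open>loc_map\<close> on arrows.\<close>

definition loc_map :: "('o, 'm) category \<Rightarrow> 'm set \<Rightarrow> 'm \<Rightarrow> ('o, 'm) loc_arrow" where
  "loc_map C W f = word_class C W (Dom C f) [Fwd f] (Cod C f)"

text \<open>\<open>Ho(M)\<close> is \<open>localization M W\<close>; \<open>fraction M W f g\<close> is \<open>g \<cdot> f\<^sup>-\<^sup>1\<close> computed there.\<close>

definition fraction :: "('o, 'm) category \<Rightarrow> 'm set \<Rightarrow> 'm \<Rightarrow> 'm \<Rightarrow> ('o, 'm) loc_arrow" where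
  "fraction M W f g =
     loc_map M W g \<cdot>\<^bsub>localization M W\<^esub> inverse_arrow (localization M W) (loc_map M W f)"

text \<open>The common value of \<open>g \<cdot> f\<^sup>-\<^sup>1\<close> on the members \<open>(f, g)\<close> of a path component; it is
  well defined by \<open>cocycle_map_path_component\<close> below.\<close>

definition cocycle_map ::
  "('o, 'm) category \<Rightarrow> 'm set \<Rightarrow> ('m \<times> 'm) set \<Rightarrow> ('o, 'm) loc_arrow" where
  "cocycle_map M W c = the_elem ((\<lambda>(f, g). fraction M W f g) ` c)"


section \<open>Basic properties\<close>

lemma homI: "\<lbrakk>f \<in> Ar C; Dom C f = X; Cod C f = Y\<rbrakk> \<Longrightarrow> f \<in> hom C X Y"
  by (simp add: hom_def)

lemma homD: "f \<in> hom C X Y \<Longrightarrow> f \<in> Ar C" "f \<in> hom C X Y \<Longrightarrow> Dom C f = X"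
  "f \<in> hom C X Y \<Longrightarrow> Cod C f = Y"
  by (simp_all add: hom_def)

context category
begin

lemma hom_Ob: assumes "f \<in> hom C X Y" shows "X \<in> Ob C" "Y \<in> Ob C"
  using assms Dom_in Cod_in by (auto simp: hom_def)

lemma category_opposite: "category (opposite C)"
proof
  fix f X Y g Z h T
  assume "f \<in> hom (opposite C) X Y" "g \<in> hom (opposite C) Y Z" "h \<in> hom (opposite C) Z T"
  then have "f \<in> hom C Y X" "g \<in> hom C Z Y" "h \<in> hom C T Z"
    by (auto simp: hom_def opposite_def)
  then show "h \<cdot>\<^bsub>opposite C\<^esub> (g \<cdot>\<^bsub>opposite C\<^esub> f) = h \<cdot>\<^bsub>opposite C\<^esub> g \<cdot>\<^bsub>opposite C\<^esub> f"
    using Cmp_assoc[of h T Z g Y f X] by (simp add: opposite_def)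
next
  fix f X Y g Z
  assume "f \<in> hom (opposite C) X Y" "g \<in> hom (opposite C) Y Z"
  then have "f \<in> hom C Y X" "g \<in> hom C Z Y" by (auto simp: hom_def opposite_def)
  then show "g \<cdot>\<^bsub>opposite C\<^esub> f \<in> hom (opposite C) X Z"
    using Cmp_hom[of g Z Y f X] by (simp add: opposite_def hom_def)
qed (use Dom_in Cod_in Idt_hom Idt_left Idt_right in \<open>auto simp: opposite_def hom_def\<close>)

lemma inverse_arrows_unique:
  assumes "inverse_arrows C f g" "inverse_arrows C f h" shows "g = h"
proof -
  have f: "f \<in> hom C (Dom C f) (Cod C f)" and g: "g \<in> hom C (Cod C f) (Dom C f)"
    and h: "h \<in> hom C (Cod C f) (Dom C f)"
    using assms by (auto simp: inverse_arrows_def hom_def)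
  have "g = g \<cdot> (f \<cdot> h)"
    using assms(2) Idt_right[OF g] by (simp add: inverse_arrows_def)
  also have "\<dots> = (g \<cdot> f) \<cdot> h" using Cmp_assoc[OF h f g] .
  also have "\<dots> = h" using assms(1) Idt_left[OF h] by (simp add: inverse_arrows_def)
  finally show ?thesis .
qed

lemma inverse_arrow_eq: "inverse_arrows C f g \<Longrightarrow> inverse_arrow C f = g"
  unfolding inverse_arrow_def by (rule the_equality) (auto intro: inverse_arrows_unique)

lemma cocycle_hom:
  "((f, g), \<alpha>, (f', g')) \<in> hom (cocycles C W X Y) c d \<longleftrightarrow>
     c = (f, g) \<and> d = (f', g') \<and>
     (f, g) \<in> Ob (cocycles C W X Y) \<and> (f', g') \<in> Ob (cocycles C W X Y) \<and>
     \<alpha> \<in> hom C (Dom C f) (Dom C f') \<and> f' \<cdot> \<alpha> = f \<and> g' \<cdot> \<alpha> = g"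
  by (auto simp: hom_def cocycles_def)

lemma cocycle_homE:
  assumes "a \<in> hom (cocycles C W X Y) c d"
  obtains f g \<alpha> f' g' where "a = ((f, g), \<alpha>, (f', g'))" "c = (f, g)" "d = (f', g')"
    "(f, g) \<in> Ob (cocycles C W X Y)" "(f', g') \<in> Ob (cocycles C W X Y)"
    "\<alpha> \<in> hom C (Dom C f) (Dom C f')" "f' \<cdot> \<alpha> = f" "g' \<cdot> \<alpha> = g"
  using assms by (auto simp: hom_def cocycles_def)

lemma cocycle_hom_PairE:
  assumes "a \<in> hom (cocycles C W X Y) (f, g) d"
  obtains \<alpha> f' g' where "a = ((f, g), \<alpha>, (f', g'))" "d = (f', g')"
    "(f', g') \<in> Ob (cocycles C W X Y)"
    "\<alpha> \<in> hom C (Dom C f) (Dom C f')" "f' \<cdot> \<alpha> = f" "g' \<cdot> \<alpha> = g"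
  using assms by (auto simp: hom_def cocycles_def)

lemma cocycle_Ob:
  "(f, g) \<in> Ob (cocycles C W X Y) \<longleftrightarrow>
     f \<in> W \<and> f \<in> hom C (Dom C f) X \<and> g \<in> hom C (Dom C f) Y"
  by (auto simp: cocycles_def hom_def)

lemma category_cocycles: "category (cocycles C W X Y)" (is "category ?H")
proof
  fix c assume c: "c \<in> Ob ?H"
  obtain f g where fg: "c = (f, g)" by (cases c)
  have "Idt ?H c = ((f, g), Idt C (Dom C f), (f, g))" by (simp add: fg cocycles_def)
  moreover have f: "f \<in> hom C (Dom C f) X" and g: "g \<in> hom C (Dom C f) Y"
    using c unfolding fg cocycle_Ob by blast+
  ultimately show "Idt ?H c \<in> hom ?H c c"
    using c Idt_hom[OF hom_Ob(1)[OF f]] Idt_right[OF f] Idt_right[OF g]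
    by (simp only: fg cocycle_hom)
next
  fix a c d b e
  assume a: "a \<in> hom ?H c d" and b: "b \<in> hom ?H d e"
  from a obtain f g \<alpha> f' g' where 1: "a = ((f, g), \<alpha>, (f', g'))" "c = (f, g)" "d = (f', g')"
    "(f, g) \<in> Ob ?H" "(f', g') \<in> Ob ?H"
    "\<alpha> \<in> hom C (Dom C f) (Dom C f')" "f' \<cdot> \<alpha> = f" "g' \<cdot> \<alpha> = g"
    by (rule cocycle_homE)
  from b[unfolded 1(3)] obtain \<beta> f'' g'' where 2: "b = ((f', g'), \<beta>, (f'', g''))" "e = (f'', g'')"
    "(f'', g'') \<in> Ob ?H"
    "\<beta> \<in> hom C (Dom C f') (Dom C f'')" "f'' \<cdot> \<beta> = f'" "g'' \<cdot> \<beta> = g'"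
    by (rule cocycle_hom_PairE)
  have "f'' \<cdot> (\<beta> \<cdot> \<alpha>) = f" "g'' \<cdot> (\<beta> \<cdot> \<alpha>) = g"
    using Cmp_assoc[OF 1(6) 2(4)] 1(7,8) 2(3,5,6) unfolding cocycle_Ob by metis+
  moreover have "b \<cdot>\<^bsub>?H\<^esub> a = ((f, g), \<beta> \<cdot> \<alpha>, (f'', g''))"
    by (simp add: 1 2 cocycles_def)
  ultimately show "b \<cdot>\<^bsub>?H\<^esub> a \<in> hom ?H c e"
    using 1(2,4) 2(2,3) Cmp_hom[OF 1(6) 2(4)] by (simp only: cocycle_hom; blast)
next
  fix a b c d e h i
  assume a: "a \<in> hom ?H d e" and b: "b \<in> hom ?H e h" and c: "c \<in> hom ?H h i"
  from a obtain f g \<alpha> f' g' where 1: "a = ((f, g), \<alpha>, (f', g'))" "e = (f', g')"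
    "\<alpha> \<in> hom C (Dom C f) (Dom C f')" by (rule cocycle_homE)
  from b[unfolded 1(2)] obtain \<beta> f'' g'' where 2: "b = ((f', g'), \<beta>, (f'', g''))" "h = (f'', g'')"
    "\<beta> \<in> hom C (Dom C f') (Dom C f'')" by (rule cocycle_hom_PairE)
  from c[unfolded 2(2)] obtain \<gamma> f3 g3 where 3: "c = ((f'', g''), \<gamma>, (f3, g3))"
    "\<gamma> \<in> hom C (Dom C f'') (Dom C f3)" by (rule cocycle_hom_PairE)
  show "c \<cdot>\<^bsub>?H\<^esub> (b \<cdot>\<^bsub>?H\<^esub> a) = c \<cdot>\<^bsub>?H\<^esub> b \<cdot>\<^bsub>?H\<^esub> a"
    using Cmp_assoc[OF 1(3) 2(3) 3(2)] by (simp add: 1(1) 2(1) 3(1) cocycles_def)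
next
  fix a c d assume "a \<in> hom ?H c d"
  then obtain f g \<alpha> f' g' where 1: "a = ((f, g), \<alpha>, (f', g'))" "c = (f, g)" "d = (f', g')"
    "\<alpha> \<in> hom C (Dom C f) (Dom C f')" by (rule cocycle_homE)
  show "a \<cdot>\<^bsub>?H\<^esub> Idt ?H c = a" "Idt ?H d \<cdot>\<^bsub>?H\<^esub> a = a"
    using Idt_left[OF 1(4)] Idt_right[OF 1(4)] by (simp_all add: 1(1-3) cocycles_def)
qed (auto simp: cocycles_def)


section \<open>The localization as a category with a universal property\<close>

lemma is_word_Ob: "is_word C W X u Y \<Longrightarrow> X \<in> Ob C \<and> Y \<in> Ob C"
proof (induction u arbitrary: X)
  case (Cons s u)
  then show ?case using Dom_in Cod_in by (cases s) (auto simp: letters_def)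
qed auto

lemma is_word_append:
  "is_word C W X (u @ v) Z \<longleftrightarrow> (\<exists>Y. is_word C W X u Y \<and> is_word C W Y v Z)"
proof (induction u arbitrary: X)
  case Nil
  then show ?case using is_word_Ob by auto
qed auto

lemma words_append:
  "\<lbrakk>u \<in> words C W X Y; v \<in> words C W Y Z\<rbrakk> \<Longrightarrow> u @ v \<in> words C W X Z"
  by (auto simp: words_def is_word_append)

lemma equiv_word_equiv: "equiv (words C W X Y) (word_equiv C W X Y)"
  unfolding word_equiv_def by (rule equiv_gen_equiv)

lemma word_equiv_sub: "word_equiv C W X Y \<subseteq> words C W X Y \<times> words C W X Y"
  by (auto simp: word_equiv_def gen_equiv_def)

lemma word_equiv_refl: "u \<in> words C W X Y \<Longrightarrow> (u, u) \<in> word_equiv C W X Y"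
  by (auto simp: word_equiv_def gen_equiv_def)

lemma word_equiv_sym: "(u, v) \<in> word_equiv C W X Y \<Longrightarrow> (v, u) \<in> word_equiv C W X Y"
  by (meson equivE equiv_word_equiv symD)

lemma word_equiv_trans:
  "\<lbrakk>(u, v) \<in> word_equiv C W X Y; (v, w) \<in> word_equiv C W X Y\<rbrakk> \<Longrightarrow> (u, w) \<in> word_equiv C W X Y"
  by (meson equivE equiv_word_equiv transD)

lemma word_equiv_basic:
  assumes "basic_rel C W a b" "a \<in> words C W X Y" "b \<in> words C W X Y"
  shows "(a, b) \<in> word_equiv C W X Y"
  unfolding word_equiv_def
proof (rule gen_equiv_base)
  have "(a, b) = ([] @ a @ [], [] @ b @ [])" by simp
  then show "(a, b) \<in> {(p @ a @ q, p @ b @ q) | p a b q. basic_rel C W a b}"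
    using assms(1) by blast
qed (use assms in auto)

lemma word_equiv_induct [consumes 1, case_names rel refl sym trans]:
  assumes "(u, v) \<in> word_equiv C W X Y"
    and "\<And>p a b q. \<lbrakk>p @ a @ q \<in> words C W X Y; p @ b @ q \<in> words C W X Y; basic_rel C W a b\<rbrakk>
           \<Longrightarrow> P (p @ a @ q) (p @ b @ q)"
    and "\<And>u. u \<in> words C W X Y \<Longrightarrow> P u u"
    and "\<And>u v. P u v \<Longrightarrow> P v u"
    and "\<And>u v w. \<lbrakk>P u v; P v w\<rbrakk> \<Longrightarrow> P u w"
  shows "P u v"
  using assms(1) unfolding word_equiv_def
proof (induction rule: gen_equiv_induct)
  case (rel x y)
  then show ?case using assms(2) by blast
qed (use assms(3-5) in blast)+

lemma word_equiv_append_right: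
  assumes "(u, u') \<in> word_equiv C W X Y" "v \<in> words C W Y Z"
  shows "(u @ v, u' @ v) \<in> word_equiv C W X Z"
  using assms(1)
proof (induction rule: word_equiv_induct)
  case (rel p a b q)
  have "(p @ a @ (q @ v), p @ b @ (q @ v)) \<in> word_equiv C W X Z"
    unfolding word_equiv_def
    by (rule gen_equiv_base)
      (use rel words_append[OF rel(1) assms(2)] words_append[OF rel(2) assms(2)] in auto)
  then show ?case by simp
qed (use assms(2) words_append in
      \<open>blast intro: word_equiv_refl word_equiv_sym word_equiv_trans\<close>)+

lemma word_equiv_append_left:
  assumes "(v, v') \<in> word_equiv C W Y Z" "u \<in> words C W X Y"
  shows "(u @ v, u @ v') \<in> word_equiv C W X Z"
  using assms(1)
proof (induction rule: word_equiv_induct)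
  case (rel p a b q)
  have "((u @ p) @ a @ q, (u @ p) @ b @ q) \<in> word_equiv C W X Z"
    unfolding word_equiv_def
  proof (rule gen_equiv_base)
    show "((u @ p) @ a @ q, (u @ p) @ b @ q) \<in> {(p @ a @ q, p @ b @ q) | p a b q. basic_rel C W a b}"
      using rel(3) by blast
  qed (use words_append[OF assms(2) rel(1)] words_append[OF assms(2) rel(2)] in simp_all)
  then show ?case by simp
qed (use assms(2) words_append in
      \<open>blast intro: word_equiv_refl word_equiv_sym word_equiv_trans\<close>)+

lemma word_class_eq:
  assumes "u \<in> words C W X Y" "v \<in> words C W X Y"
  shows "word_class C W X u Y = word_class C W X v Y \<longleftrightarrow> (u, v) \<in> word_equiv C W X Y"
  unfolding word_class_def using eq_equiv_class_iff[OF equiv_word_equiv assms] by simp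

lemma loc_hom:
  "a \<in> hom (localization C W) X Y \<longleftrightarrow> (\<exists>u\<in>words C W X Y. a = word_class C W X u Y)"
  by (auto simp: hom_def localization_def word_class_def words_def quotient_def
      dest: is_word_Ob)

lemma loc_homE:
  assumes "a \<in> hom (localization C W) X Y"
  obtains u where "u \<in> words C W X Y" "a = word_class C W X u Y"
  using assms loc_hom by blast

lemma word_class_hom:
  "u \<in> words C W X Y \<Longrightarrow> word_class C W X u Y \<in> hom (localization C W) X Y"
  using loc_hom by blast

lemma loc_Cmp:
  assumes u: "u \<in> words C W X Y" and v: "v \<in> words C W Y Z"
  shows "word_class C W Y v Z \<cdot>\<^bsub>localization C W\<^esub> word_class C W X u Y =
         word_class C W X (u @ v) Z"
proof -
  let ?R = "word_equiv C W X Z"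
  have *: "?R `` {u' @ v'} = ?R `` {u @ v}"
    if "(u, u') \<in> word_equiv C W X Y" "(v, v') \<in> word_equiv C W Y Z" for u' v'
  proof -
    have v': "v' \<in> words C W Y Z" using that word_equiv_sub by blast
    have "(u @ v, u' @ v') \<in> ?R"
      using word_equiv_trans[OF word_equiv_append_left[OF that(2) u]
          word_equiv_append_right[OF that(1) v']] .
    then show ?thesis using equiv_class_eq[OF equiv_word_equiv] by metis
  qed
  let ?A = "word_equiv C W X Y `` {u}" and ?B = "word_equiv C W Y Z `` {v}"
  have "(\<Union>u'\<in>?A. \<Union>v'\<in>?B. ?R `` {u' @ v'}) = (\<Union>u'\<in>?A. \<Union>v'\<in>?B. ?R `` {u @ v})"
    by (intro SUP_cong refl *) (simp_all add: Image_singleton_iff)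
  also have "\<dots> = ?R `` {u @ v}"
  proof -
    have "u \<in> ?A" "v \<in> ?B" using word_equiv_refl u v by blast+
    then have "?A \<noteq> {}" "?B \<noteq> {}" by blast+
    then show ?thesis by simp
  qed
  finally show ?thesis by (simp add: localization_def word_class_def)
qed

lemma Nil_words: "X \<in> Ob C \<Longrightarrow> [] \<in> words C W X X"
  by (simp add: words_def)

lemma loc_Ob [simp]: "Ob (localization C W) = Ob C"
  by (simp add: localization_def)

lemma loc_Idt: "Idt (localization C W) X = word_class C W X [] X"
  by (simp add: localization_def)

lemma words_Ob: "u \<in> words C W X Y \<Longrightarrow> X \<in> Ob C" "u \<in> words C W X Y \<Longrightarrow> Y \<in> Ob C"
  using is_word_Ob by (auto simp: words_def)

lemma category_localization: "category (localization C W)" (is "category ?L")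
proof
  fix X assume "X \<in> Ob ?L"
  then show "Idt ?L X \<in> hom ?L X X" using Nil_words word_class_hom loc_Idt by simp
next
  fix f X Y g Z
  assume "f \<in> hom ?L X Y" "g \<in> hom ?L Y Z"
  then show "g \<cdot>\<^bsub>?L\<^esub> f \<in> hom ?L X Z"
    by (elim loc_homE) (simp add: loc_Cmp word_class_hom words_append)
next
  fix f X Y g Z h T
  assume "f \<in> hom ?L X Y" "g \<in> hom ?L Y Z" "h \<in> hom ?L Z T"
  then show "h \<cdot>\<^bsub>?L\<^esub> (g \<cdot>\<^bsub>?L\<^esub> f) = h \<cdot>\<^bsub>?L\<^esub> g \<cdot>\<^bsub>?L\<^esub> f"
    by (elim loc_homE) (simp add: loc_Cmp words_append)
next
  fix f X Y assume "f \<in> hom ?L X Y"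
  then obtain u where u: "u \<in> words C W X Y" "f = word_class C W X u Y" by (rule loc_homE)
  show "f \<cdot>\<^bsub>?L\<^esub> Idt ?L X = f"
    using loc_Cmp[OF Nil_words[OF words_Ob(1)[OF u(1)]] u(1)] by (simp add: u(2) loc_Idt)
  show "Idt ?L Y \<cdot>\<^bsub>?L\<^esub> f = f"
    using loc_Cmp[OF u(1) Nil_words[OF words_Ob(2)[OF u(1)]]] by (simp add: u(2) loc_Idt)
qed (auto simp: localization_def)

lemma Fwd_words: "f \<in> hom C X Y \<Longrightarrow> [Fwd f] \<in> words C W X Y"
  using Cod_in by (auto simp: words_def letters_def hom_def)

lemma Bwd_words: "\<lbrakk>w \<in> W; w \<in> hom C X Y\<rbrakk> \<Longrightarrow> [Bwd w] \<in> words C W Y X"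
  using Dom_in by (auto simp: words_def letters_def hom_def)

lemma loc_map_eq: "f \<in> hom C X Y \<Longrightarrow> loc_map C W f = word_class C W X [Fwd f] Y"
  by (auto simp: loc_map_def hom_def)

lemma loc_map_hom: "f \<in> hom C X Y \<Longrightarrow> loc_map C W f \<in> hom (localization C W) X Y"
  by (simp add: loc_map_eq word_class_hom Fwd_words)

lemma loc_map_Cmp:
  assumes f: "f \<in> hom C X Y" and g: "g \<in> hom C Y Z"
  shows "loc_map C W (g \<cdot> f) = loc_map C W g \<cdot>\<^bsub>localization C W\<^esub> loc_map C W f"
proof -
  have "basic_rel C W [Fwd f, Fwd g] [Fwd (g \<cdot> f)]"
    using f g by (auto simp: hom_def intro: basic_rel.comp)
  then have "([Fwd f, Fwd g], [Fwd (g \<cdot> f)]) \<in> word_equiv C W X Z"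
    using words_append[OF Fwd_words[OF f] Fwd_words[OF g]] Fwd_words[OF Cmp_hom[OF f g]]
    by (auto intro: word_equiv_basic)
  then have "word_class C W X [Fwd f, Fwd g] Z = word_class C W X [Fwd (g \<cdot> f)] Z"
    using word_equiv_sub word_class_eq by blast
  then show ?thesis
    using loc_Cmp[OF Fwd_words[OF f] Fwd_words[OF g]]
    by (simp add: loc_map_eq[OF f] loc_map_eq[OF g] loc_map_eq[OF Cmp_hom[OF f g]])
qed

lemma loc_map_Idt:
  assumes "X \<in> Ob C" shows "loc_map C W (Idt C X) = Idt (localization C W) X"
proof -
  have "([Fwd (Idt C X)], []) \<in> word_equiv C W X X"
    using assms by (intro word_equiv_basic basic_rel.idt Fwd_words Idt_hom Nil_words)
  then show ?thesis
    using word_equiv_sub word_class_eq by (metis loc_Idt loc_map_eq[OF Idt_hom[OF assms]]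
        Fwd_words[OF Idt_hom[OF assms]] Nil_words[OF assms])
qed

lemma functor_loc_map: "is_functor C (localization C W) (\<lambda>X. X) (loc_map C W)"
  unfolding is_functor_def
  by (auto simp: loc_map_Idt intro!: loc_map_hom loc_map_Cmp homI)

lemma inverse_arrows_loc_map:
  assumes w: "w \<in> W" "w \<in> hom C X Y"
  shows "inverse_arrows (localization C W) (loc_map C W w) (word_class C W Y [Bwd w] X)"
proof -
  note F = Fwd_words[OF w(2)] and B = Bwd_words[OF w]
  have WA: "w \<in> W \<inter> Ar C" using w by (simp add: hom_def)
  have Ob: "X \<in> Ob C" "Y \<in> Ob C" using hom_Ob[OF w(2)] by auto
  have "([Fwd w, Bwd w], []) \<in> word_equiv C W X X"
    using words_append[OF F B] Nil_words[OF Ob(1)] basic_rel.right_inv[OF WA]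
    by (simp add: word_equiv_basic)
  then have 1: "word_class C W X [Fwd w, Bwd w] X = word_class C W X [] X"
    using word_equiv_sub word_class_eq by blast
  have "([Bwd w, Fwd w], []) \<in> word_equiv C W Y Y"
    using words_append[OF B F] Nil_words[OF Ob(2)] basic_rel.left_inv[OF WA]
    by (simp add: word_equiv_basic)
  then have 2: "word_class C W Y [Bwd w, Fwd w] Y = word_class C W Y [] Y"
    using word_equiv_sub word_class_eq by blast
  show ?thesis
    unfolding inverse_arrows_def
    using loc_Cmp[OF F B] loc_Cmp[OF B F] 1 2 word_class_hom[OF B] homD[OF word_class_hom[OF F]]
    by (simp add: loc_map_eq[OF w(2)] loc_Idt)
qed

lemma inverse_loc_map:
  "\<lbrakk>w \<in> W; w \<in> hom C X Y\<rbrakk>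
     \<Longrightarrow> inverse_arrow (localization C W) (loc_map C W w) = word_class C W Y [Bwd w] X"
  using category.inverse_arrow_eq[OF category_localization inverse_arrows_loc_map] .

lemma fraction_eq:
  assumes "f \<in> W" "f \<in> hom C Z X" "g \<in> hom C Z Y"
  shows "fraction C W f g = word_class C W X [Bwd f, Fwd g] Y"
  using loc_Cmp[OF Bwd_words[OF assms(1,2)] Fwd_words[OF assms(3)]]
  by (simp add: fraction_def inverse_loc_map[OF assms(1,2)] loc_map_eq[OF assms(3)])

lemma localization_extension_unique:
  assumes D: "category D"
    and G: "is_functor (localization C W) D Go Gm"
    and H: "is_functor (localization C W) D Go Hm"
    and eq: "\<And>f. f \<in> Ar C \<Longrightarrow> Gm (loc_map C W f) = Hm (loc_map C W f)"
    and a: "a \<in> Ar (localization C W)"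
  shows "Gm a = Hm a"
proof -
  let ?L = "localization C W"
  have cmp: "Km (word_class C W Y v Z \<cdot>\<^bsub>?L\<^esub> word_class C W X u Y) =
        Km (word_class C W Y v Z) \<cdot>\<^bsub>D\<^esub> Km (word_class C W X u Y)"
    if "is_functor ?L D Go Km" "u \<in> words C W X Y" "v \<in> words C W Y Z" for Km u v X Y Z
    using that word_class_hom[OF that(2)] word_class_hom[OF that(3)]
    by (auto simp: is_functor_def hom_def)
  have inv: "inverse_arrows D (Km (loc_map C W w)) (Km (word_class C W Y [Bwd w] X))"
    if K: "is_functor ?L D Go Km" and w: "w \<in> W" "w \<in> hom C X Y" for Km w X Y
  proof -
    note F = Fwd_words[OF w(2)] and B = Bwd_words[OF w]
    have k: "Km (loc_map C W w) \<in> hom D (Go X) (Go Y)"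
      "Km (word_class C W Y [Bwd w] X) \<in> hom D (Go Y) (Go X)"
      using K loc_map_hom[OF w(2)] word_class_hom[OF B] by (auto simp: is_functor_def hom_def)
    have i: "word_class C W Y [Bwd w] X \<cdot>\<^bsub>?L\<^esub> loc_map C W w = Idt ?L X"
      "loc_map C W w \<cdot>\<^bsub>?L\<^esub> word_class C W Y [Bwd w] X = Idt ?L Y"
      using inverse_arrows_loc_map[OF w] loc_map_hom[OF w(2)]
      by (auto simp: inverse_arrows_def hom_def)
    have "Km (word_class C W Y [Bwd w] X) \<cdot>\<^bsub>D\<^esub> Km (loc_map C W w) = Idt D (Go X)"
      "Km (loc_map C W w) \<cdot>\<^bsub>D\<^esub> Km (word_class C W Y [Bwd w] X) = Idt D (Go Y)"
      using cmp[OF K F B] cmp[OF K B F] i K hom_Ob[OF w(2)]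
      by (simp_all add: loc_map_eq[OF w(2)] is_functor_def)
    then show ?thesis using k by (simp add: inverse_arrows_def hom_def)
  qed
  have single: "Gm (word_class C W X [s] Y) = Hm (word_class C W X [s] Y)"
    if "[s] \<in> words C W X Y" for s X Y
  proof (cases s)
    case (Fwd f)
    then have "f \<in> hom C X Y" using that by (auto simp: words_def letters_def hom_def)
    then show ?thesis using eq loc_map_eq Fwd homD(1) by metis
  next
    case (Bwd w)
    then have w: "w \<in> W" "w \<in> hom C Y X" using that by (auto simp: words_def letters_def hom_def)
    then have "Gm (loc_map C W w) = Hm (loc_map C W w)" using eq by (simp add: hom_def)
    then show ?thesis
      using inv[OF G w] inv[OF H w] category.inverse_arrows_unique[OF D] Bwd by metis
  qed
  have "Gm (word_class C W X u Y) = Hm (word_class C W X u Y)" if "u \<in> words C W X Y" for u X Y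
    using that
  proof (induction u arbitrary: X)
    case Nil
    then show ?case using G H by (auto simp: words_def is_functor_def loc_Idt[symmetric])
  next
    case (Cons s u)
    define T where "T = letter_tgt C s"
    have u: "u \<in> words C W T Y" using Cons(2) by (simp add: words_def T_def)
    then have s: "[s] \<in> words C W X T" using Cons(2) words_Ob(1)[OF u]
      by (simp add: words_def T_def)
    show ?case
      using cmp[OF G s u] cmp[OF H s u] loc_Cmp[OF s u] Cons(1)[OF u] single[OF s] by simp
  qed
  then show ?thesis using a homI[of a ?L, OF a refl refl] loc_hom by metis
qed

end

primrec eval_letter :: "('p, 'n) category \<Rightarrow> ('m \<Rightarrow> 'n) \<Rightarrow> 'm letter \<Rightarrow> 'n" where
  "eval_letter D Fm (Fwd f) = Fm f"
| "eval_letter D Fm (Bwd w) = inverse_arrow D (Fm w)"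

primrec eval_word ::
  "('o, 'm) category \<Rightarrow> ('p, 'n) category \<Rightarrow> ('o \<Rightarrow> 'p) \<Rightarrow> ('m \<Rightarrow> 'n) \<Rightarrow> 'o \<Rightarrow> 'm letter list \<Rightarrow> 'n"
  where
  "eval_word C D Fo Fm X [] = Idt D (Fo X)"
| "eval_word C D Fo Fm X (s # u) =
     eval_word C D Fo Fm (letter_tgt C s) u \<cdot>\<^bsub>D\<^esub> eval_letter D Fm s"

context category
begin

lemma localization_extension:
  assumes D: "category D" and F: "is_functor C D Fo Fm"
    and iso: "\<And>w. w \<in> W \<inter> Ar C \<Longrightarrow> is_iso D (Fm w)"
  shows "\<exists>Gm. is_functor (localization C W) D Fo Gm \<and> (\<forall>f\<in>Ar C. Gm (loc_map C W f) = Fm f)"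
proof -
  interpret D: category D by (rule D)
  let ?L = "localization C W"
  let ?e = "eval_word C D Fo Fm"
  have Fhom: "Fm f \<in> hom D (Fo X) (Fo Y)" if "f \<in> hom C X Y" for f X Y
    using F that by (auto simp: is_functor_def hom_def)
  have Finv: "inverse_arrows D (Fm w) (inverse_arrow D (Fm w))" if "w \<in> W \<inter> Ar C" for w
    using iso[OF that] D.inverse_arrow_eq unfolding is_iso_def by blast
  have Foob: "Fo X \<in> Ob D" if "X \<in> Ob C" for X
    using F that by (auto simp: is_functor_def)
  have letter: "eval_letter D Fm s \<in> hom D (Fo (letter_src C s)) (Fo (letter_tgt C s))"
    if "s \<in> letters C W" for s
  proof (cases s)
    case (Fwd f)
    then have "f \<in> Ar C" using that by (auto simp: letters_def)
    then show ?thesis using Fhom[of f "Dom C f" "Cod C f"] Fwd by (simp add: hom_def)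
  next
    case (Bwd w)
    then have w: "w \<in> W \<inter> Ar C" using that by (auto simp: letters_def)
    then show ?thesis
      using Finv[OF w] Fhom[of w "Dom C w" "Cod C w"] Bwd
      by (auto simp: inverse_arrows_def hom_def)
  qed
  have word: "?e X u \<in> hom D (Fo X) (Fo Y)" if "is_word C W X u Y" for X u Y
    using that
  proof (induction u arbitrary: X)
    case Nil
    then show ?case using D.Idt_hom Foob by auto
  next
    case (Cons s u)
    then show ?case using D.Cmp_hom[OF letter[of s] Cons(1)[of "letter_tgt C s"]] by auto
  qed
  have app: "?e X (u @ v) = ?e Y v \<cdot>\<^bsub>D\<^esub> ?e X u" if "is_word C W X u Y" "is_word C W Y v Z"
    for X u Y v Z
    using that(1)
  proof (induction u arbitrary: X)
    case Nil
    then show ?case using D.Idt_right[OF word[OF that(2)]] by auto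
  next
    case (Cons s u)
    then have s: "s \<in> letters C W" and u: "is_word C W (letter_tgt C s) u Y" by auto
    show ?case using Cons(1)[OF u] D.Cmp_assoc[OF letter[OF s] word[OF u] word[OF that(2)]] by simp
  qed
  have basic: "?e X a = ?e X b" if "basic_rel C W a b" "is_word C W X a Y" for a b X Y
    using that
  proof (induction rule: basic_rel.induct)
    case (comp f g)
    then have f: "f \<in> hom C (Dom C f) (Dom C g)" and g: "g \<in> hom C (Dom C g) (Cod C g)"
      by (auto simp: hom_def)
    have gf: "Cod C (g \<cdot> f) = Cod C g" using Cmp_hom[OF f g] by (simp add: hom_def)
    have "Fm (g \<cdot> f) = Fm g \<cdot>\<^bsub>D\<^esub> Fm f" using F comp by (auto simp: is_functor_def)
    then show ?case
      using D.Idt_left[OF Fhom[OF g]] D.Idt_left[OF Fhom[OF Cmp_hom[OF f g]]] gf by simp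
  next
    case (idt Z)
    then have Z: "X = Z" "Cod C (Idt C Z) = Z" using Idt_hom[of Z] by (auto simp: hom_def)
    have "Fm (Idt C Z) = Idt D (Fo Z)" using F idt by (auto simp: is_functor_def)
    then show ?case using D.Idt_left[OF D.Idt_hom[OF Foob[OF idt(1)]]] Z by simp
  next
    case (right_inv w)
    have w: "Fm w \<in> hom D (Fo (Dom C w)) (Fo (Cod C w))"
      using Fhom[of w] right_inv by (auto simp: hom_def)
    have i: "inverse_arrow D (Fm w) \<in> hom D (Fo (Cod C w)) (Fo (Dom C w))"
      "inverse_arrow D (Fm w) \<cdot>\<^bsub>D\<^esub> Fm w = Idt D (Fo (Dom C w))"
      using Finv[OF right_inv(1)] w by (auto simp: inverse_arrows_def hom_def)
    show ?case using D.Idt_left[OF i(1)] i(2) right_inv by auto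
  next
    case (left_inv w)
    have w: "Fm w \<in> hom D (Fo (Dom C w)) (Fo (Cod C w))"
      using Fhom[of w] left_inv by (auto simp: hom_def)
    have i: "Fm w \<cdot>\<^bsub>D\<^esub> inverse_arrow D (Fm w) = Idt D (Fo (Cod C w))"
      using Finv[OF left_inv(1)] w by (auto simp: inverse_arrows_def hom_def)
    show ?case using D.Idt_left[OF w] i left_inv by auto
  qed
  have basic_word: "is_word C W X b Y" if "basic_rel C W a b" "is_word C W X a Y" for a b X Y
    using that
  proof (induction rule: basic_rel.induct)
    case (comp f g)
    then have "g \<cdot> f \<in> hom C (Dom C f) (Cod C g)" by (intro Cmp_hom) (auto simp: hom_def)
    then show ?case using comp by (auto simp: letters_def hom_def)
  next
    case (idt Z)
    then show ?case using Idt_hom[of Z] by (auto simp: hom_def)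
  qed (use Dom_in Cod_in in auto)
  have resp: "?e X u = ?e X v" if "(u, v) \<in> word_equiv C W X Y" for u v X Y
    using that
  proof (induction rule: word_equiv_induct)
    case (rel p a b q)
    then obtain S T where *: "is_word C W X p S" "is_word C W S a T" "is_word C W T q Y"
      by (auto simp: words_def is_word_append)
    have b: "is_word C W S b T" using basic_word[OF rel(3) *(2)] .
    have "is_word C W S (a @ q) Y" "is_word C W S (b @ q) Y"
      using * b by (auto simp: is_word_append)
    then show ?case
      using app[OF *(1)] app[OF *(2,3)] app[OF b *(3)] basic[OF rel(3) *(2)] by simp
  qed auto
  define Gm where "Gm = (\<lambda>(X, c, Y :: 'o). the_elem (?e X ` c))"
  have Gm: "Gm (word_class C W X u Y) = ?e X u" if "u \<in> words C W X Y" for X u Y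
  proof -
    have "?e X w = ?e X u" if "w \<in> word_equiv C W X Y `` {u}" for w
      using that resp[of u w X Y] by simp
    moreover have "u \<in> word_equiv C W X Y `` {u}" using word_equiv_refl[OF that] by simp
    ultimately have "?e X ` (word_equiv C W X Y `` {u}) = {?e X u}" by blast
    then show ?thesis by (simp add: Gm_def word_class_def)
  qed
  have "is_functor ?L D Fo Gm"
    unfolding is_functor_def
  proof (intro conjI ballI impI)
    fix X assume X: "X \<in> Ob ?L"
    then show "Fo X \<in> Ob D" using Foob by simp
    show "Gm (Idt ?L X) = Idt D (Fo X)" using Gm[OF Nil_words] X by (simp add: loc_Idt)
  next
    fix f assume "f \<in> Ar ?L"
    then obtain u where "u \<in> words C W (Dom ?L f) (Cod ?L f)"
      "f = word_class C W (Dom ?L f) u (Cod ?L f)"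
      using loc_homE[OF homI[OF _ refl refl]] by metis
    then show "Gm f \<in> hom D (Fo (Dom ?L f)) (Fo (Cod ?L f))"
      using Gm word by (metis mem_Collect_eq words_def)
  next
    fix f g assume fg: "f \<in> Ar ?L" "g \<in> Ar ?L" "Cod ?L f = Dom ?L g"
    obtain u where u: "u \<in> words C W (Dom ?L f) (Dom ?L g)"
      "f = word_class C W (Dom ?L f) u (Dom ?L g)"
      using loc_homE[OF homI[OF fg(1) refl fg(3)]] by metis
    obtain v where v: "v \<in> words C W (Dom ?L g) (Cod ?L g)"
      "g = word_class C W (Dom ?L g) v (Cod ?L g)"
      using loc_homE[OF homI[OF fg(2) refl refl]] by metis
    have "Gm (g \<cdot>\<^bsub>?L\<^esub> f) = ?e (Dom ?L f) (u @ v)"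
      using loc_Cmp[OF u(1) v(1)] u(2) v(2) Gm[OF words_append[OF u(1) v(1)]] by metis
    also have "\<dots> = ?e (Dom ?L g) v \<cdot>\<^bsub>D\<^esub> ?e (Dom ?L f) u"
      using app u(1) v(1) by (simp add: words_def)
    also have "\<dots> = Gm g \<cdot>\<^bsub>D\<^esub> Gm f" using Gm[OF u(1)] Gm[OF v(1)] u(2) v(2) by metis
    finally show "Gm (g \<cdot>\<^bsub>?L\<^esub> f) = Gm g \<cdot>\<^bsub>D\<^esub> Gm f" .
  qed
  moreover have "Gm (loc_map C W f) = Fm f" if "f \<in> Ar C" for f
  proof -
    have f: "f \<in> hom C (Dom C f) (Cod C f)" using that by (simp add: hom_def)
    show ?thesis
      using Gm[OF Fwd_words[OF f]] D.Idt_left[OF Fhom[OF f]] by (simp add: loc_map_def)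
  qed
  ultimately show ?thesis by blast
qed

lemma fraction_path_component:
  assumes "(c, d) \<in> connected_rel (cocycles C W X Y)"
  shows "case_prod (fraction C W) c = case_prod (fraction C W) d"
  using assms unfolding connected_rel_def
proof (induction rule: gen_equiv_induct)
  case (rel c d)
  let ?L = "localization C W"
  from rel obtain a where "a \<in> hom (cocycles C W X Y) c d" by auto
  then obtain f g \<alpha> f' g' where 1: "c = (f, g)" "d = (f', g')"
    "(f, g) \<in> Ob (cocycles C W X Y)" "(f', g') \<in> Ob (cocycles C W X Y)"
    "\<alpha> \<in> hom C (Dom C f) (Dom C f')" "f' \<cdot> \<alpha> = f" "g' \<cdot> \<alpha> = g"
    by (rule cocycle_homE)
  define Z Z' where "Z = Dom C f" and "Z' = Dom C f'"
  have f: "f \<in> W" "f \<in> hom C Z X" and g: "g \<in> hom C Z Y"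
    and f': "f' \<in> W" "f' \<in> hom C Z' X" and g': "g' \<in> hom C Z' Y" and \<alpha>: "\<alpha> \<in> hom C Z Z'"
    using 1 by (auto simp: cocycle_Ob Z_def Z'_def)
  interpret L: category ?L by (rule category_localization)
  define i where "i = inverse_arrow ?L (loc_map C W f)"
  define i' where "i' = inverse_arrow ?L (loc_map C W f')"
  let ?a = "loc_map C W \<alpha>" and ?f = "loc_map C W f" and ?f' = "loc_map C W f'"
    and ?g' = "loc_map C W g'"
  note ah = loc_map_hom[OF \<alpha>, of W] and fh = loc_map_hom[OF f(2), of W]
    and fh' = loc_map_hom[OF f'(2), of W] and gh' = loc_map_hom[OF g', of W]
  have ia: "inverse_arrows ?L ?f i" "inverse_arrows ?L ?f' i'"
    using inverse_arrows_loc_map f f' inverse_loc_map i_def i'_def by auto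
  have ih: "i \<in> hom ?L X Z" "i \<cdot>\<^bsub>?L\<^esub> ?f = Idt ?L Z" "?f \<cdot>\<^bsub>?L\<^esub> i = Idt ?L X"
    "i' \<in> hom ?L X Z'" "i' \<cdot>\<^bsub>?L\<^esub> ?f' = Idt ?L Z'" "?f' \<cdot>\<^bsub>?L\<^esub> i' = Idt ?L X"
    using ia fh fh' by (auto simp: inverse_arrows_def hom_def)
  have "i' = i' \<cdot>\<^bsub>?L\<^esub> (?f \<cdot>\<^bsub>?L\<^esub> i)" using ih L.Idt_right by simp
  also have "?f = ?f' \<cdot>\<^bsub>?L\<^esub> ?a" using loc_map_Cmp[OF \<alpha> f'(2)] 1 by simp
  also have "i' \<cdot>\<^bsub>?L\<^esub> (?f' \<cdot>\<^bsub>?L\<^esub> ?a \<cdot>\<^bsub>?L\<^esub> i) = i' \<cdot>\<^bsub>?L\<^esub> (?f' \<cdot>\<^bsub>?L\<^esub> (?a \<cdot>\<^bsub>?L\<^esub> i))"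
    using L.Cmp_assoc[OF ih(1) ah fh'] by simp
  also have "\<dots> = i' \<cdot>\<^bsub>?L\<^esub> ?f' \<cdot>\<^bsub>?L\<^esub> (?a \<cdot>\<^bsub>?L\<^esub> i)"
    using L.Cmp_assoc[OF L.Cmp_hom[OF ih(1) ah] fh' ih(4)] .
  also have "\<dots> = ?a \<cdot>\<^bsub>?L\<^esub> i" using ih(5) L.Idt_left[OF L.Cmp_hom[OF ih(1) ah]] by simp
  finally have "?g' \<cdot>\<^bsub>?L\<^esub> i' = ?g' \<cdot>\<^bsub>?L\<^esub> ?a \<cdot>\<^bsub>?L\<^esub> i"
    using L.Cmp_assoc[OF ih(1) ah gh'] by simp
  also have "?g' \<cdot>\<^bsub>?L\<^esub> ?a = loc_map C W g" using loc_map_Cmp[OF \<alpha> g'] 1 by simp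
  finally show ?case by (simp add: 1(1,2) fraction_def i_def i'_def)
qed auto

lemma cocycle_map_path_component:
  assumes "(f, g) \<in> Ob (cocycles C W X Y)"
  shows "cocycle_map C W (path_component (cocycles C W X Y) (f, g)) = fraction C W f g"
proof -
  let ?c = "path_component (cocycles C W X Y) (f, g)"
  have "(f, g) \<in> ?c"
    using assms by (simp add: path_component_def connected_rel_def gen_equiv_def)
  moreover have "case_prod (fraction C W) d = case_prod (fraction C W) (f, g)" if "d \<in> ?c" for d
    using that fraction_path_component[of "(f, g)" d W X Y] by (simp add: path_component_def)
  ultimately have "case_prod (fraction C W) ` ?c = {case_prod (fraction C W) (f, g)}" by blast
  then show ?thesis by (simp add: cocycle_map_def)
qed

end

end

theory Submission
  imports Defs "HOL-Library.FuncSet"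
begin

text \<open>A weak equivalence \<open>w: Y \<rightarrow> Y'\<close> induces a bijection \<open>\<pi>\<^sub>0 H(X, Y) \<rightarrow> \<pi>\<^sub>0 H(X, Y')\<close>: factor a
  cocycle \<open>Z \<rightarrow> Y' \<times> X\<close> as a trivial cofibration followed by a fibration, and pull the fibration
  back along the weak equivalence \<open>w \<times> 1\<close>; by right properness the result is a cocycle.  Hence
  \<open>\<pi>\<^sub>0 H(X, -)\<close> is a set-valued functor inverting \<open>W\<close>, so it extends to the localization.  Acting on
  the class of \<open>(1, 1)\<close> sends an arrow \<open>X \<rightarrow> Y\<close> of the localization to an element of \<open>\<pi>\<^sub>0 H(X, Y)\<close>,
  and this inverts \<open>\<phi>\<close>: one composite is the identity by naturality of \<open>\<phi>\<close>, the other because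
  \<open>f: (f, f) \<rightarrow> (1, 1)\<close> is a morphism of cocycles, so that \<open>f\<^sup>-\<^sup>1\<close> carries the class of \<open>(1, 1)\<close> to
  that of \<open>(f, 1)\<close>.\<close>


section \<open>Products and pullbacks from finite limits\<close>

context category
begin

lemma ex_product:
  assumes lim: "has_finite_limits C" and X: "X \<in> Ob C" and Y: "Y \<in> Ob C"
  obtains P p q where "is_product C X Y P p q"
proof -
  \<comment> \<open>The discrete category on two objects, with objects serving as their own
    identities; composable arrows coincide, so the composite may be taken to be either of
    them.\<close>
  define J :: "(nat, nat) category" where
    "J = \<lparr>Ob = {0, 1}, Ar = {0, 1}, Dom = id, Cod = id, Idt = id, Cmp = (\<lambda>g f. f)\<rparr>"
  define Fo where "Fo i = (if i = (0::nat) then X else Y)" for i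
  have "category J" by unfold_locales (auto simp: J_def hom_def)
  moreover have "is_functor J C Fo (\<lambda>i. Idt C (Fo i))"
    using Idt_hom[OF X] Idt_hom[OF Y] Idt_left[OF Idt_hom[OF X]] Idt_left[OF Idt_hom[OF Y]] X Y
    by (auto simp: is_functor_def J_def Fo_def)
  moreover have "finite (Ob J)" "finite (Ar J)" by (simp_all add: J_def)
  ultimately obtain L leg where L: "is_limit J C Fo (\<lambda>i. Idt C (Fo i)) L leg"
    using lim unfolding has_finite_limits_def by blast
  have cone: "is_cone J C Fo (\<lambda>i. Idt C (Fo i)) N k \<longleftrightarrow> k 0 \<in> hom C N X \<and> k 1 \<in> hom C N Y"
    for N k
    using Idt_left hom_Ob by (auto simp: is_cone_def J_def Fo_def)
  have "\<exists>!h. h \<in> hom C N L \<and> leg 0 \<cdot> h = a \<and> leg 1 \<cdot> h = b"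
    if "a \<in> hom C N X" "b \<in> hom C N Y" for N a b
  proof -
    define k where "k i = (if i = (0::nat) then a else b)" for i
    have "is_cone J C Fo (\<lambda>i. Idt C (Fo i)) N k" using that by (simp add: cone k_def)
    then have "\<exists>!h. h \<in> hom C N L \<and> (\<forall>i\<in>Ob J. leg i \<cdot> h = k i)"
      using L unfolding is_limit_def by blast
    then show ?thesis by (simp add: J_def k_def)
  qed
  moreover have "leg 0 \<in> hom C L X" "leg 1 \<in> hom C L Y"
    using L by (simp_all add: is_limit_def cone)
  ultimately have "is_product C X Y L (leg 0) (leg 1)" by (simp add: is_product_def)
  then show ?thesis by (rule that)
qed

lemma ex_pullback:
  assumes lim: "has_finite_limits C" and f: "f \<in> hom C X Z" and g: "g \<in> hom C Y Z"
  obtains p q where "is_pullback C f g p q"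
proof -
  text \<open>The walking cospan: the arrow \<open>3\<close> is \<open>0 \<rightarrow> 2\<close>, the arrow \<open>4\<close> is \<open>1 \<rightarrow> 2\<close>, and
    \<open>0\<close>, \<open>1\<close>, \<open>2\<close> are the identities.\<close>
  define J :: "(nat, nat) category" where
    "J = \<lparr>Ob = {0, 1, 2}, Ar = {0, 1, 2, 3, 4},
          Dom = (\<lambda>u. if u = 3 then 0 else if u = 4 then 1 else u),
          Cod = (\<lambda>u. if u = 3 \<or> u = 4 then 2 else u),
          Idt = id, Cmp = (\<lambda>v u. if u < 3 then v else u)\<rparr>"
  define Fo where "Fo i = (if i = (0::nat) then X else if i = 1 then Y else Z)" for i
  define Fm where
    "Fm u = (if u = (3::nat) then f else if u = 4 then g else Idt C (Fo u))" for u
  note [simp] = hom_Ob[OF f] hom_Ob[OF g] Idt_right[OF f] Idt_right[OF g] Idt_left[OF f]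
    Idt_left[OF g] Idt_hom f g Idt_left[OF Idt_hom]
  have "category J" by unfold_locales (auto simp: J_def hom_def split: if_splits)
  moreover have "is_functor J C Fo Fm"
    by (auto simp: is_functor_def J_def Fo_def Fm_def)
  moreover have "finite (Ob J)" "finite (Ar J)" by (simp_all add: J_def)
  ultimately obtain L leg where L: "is_limit J C Fo Fm L leg"
    using lim unfolding has_finite_limits_def by blast
  have cone: "is_cone J C Fo Fm N k \<longleftrightarrow> k 0 \<in> hom C N X \<and> k 1 \<in> hom C N Y \<and>
      f \<cdot> k 0 = k 2 \<and> g \<cdot> k 1 = k 2" for N k
    using Idt_left hom_Ob Cmp_hom[OF _ f, of "k 0" N]
    by (auto simp: is_cone_def J_def Fo_def Fm_def)
  have l: "leg 0 \<in> hom C L X" "leg 1 \<in> hom C L Y" "f \<cdot> leg 0 = leg 2" "g \<cdot> leg 1 = leg 2"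
    using L by (simp_all add: is_limit_def cone)
  have "\<exists>!h. h \<in> hom C N L \<and> leg 0 \<cdot> h = a \<and> leg 1 \<cdot> h = b"
    if ab: "a \<in> hom C N X" "b \<in> hom C N Y" "f \<cdot> a = g \<cdot> b" for N a b
  proof -
    define k where "k i = (if i = (0::nat) then a else if i = 1 then b else f \<cdot> a)" for i
    have "is_cone J C Fo Fm N k" using ab by (simp add: cone k_def)
    then have "\<exists>!h. h \<in> hom C N L \<and> (\<forall>i\<in>Ob J. leg i \<cdot> h = k i)"
      using L unfolding is_limit_def by blast
    \<comment> \<open>The leg to the corner \<open>Z\<close> is forced by the leg to
      \<open>X\<close>, so the limit's condition at the object \<open>2\<close> follows from the one
      at \<open>0\<close>.\<close>
    moreover have "leg 2 \<cdot> h = f \<cdot> a" if "h \<in> hom C N L" "leg 0 \<cdot> h = a" for h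
      using Cmp_assoc[OF that(1) l(1) f] l(3) that(2) by simp
    ultimately show ?thesis by (simp add: J_def k_def) metis
  qed
  then have "is_pullback C f g (leg 0) (leg 1)"
    using l f g by (auto simp: is_pullback_def hom_def)
  then show ?thesis by (rule that)
qed

lemma product_map_eqI:
  assumes "is_product C X Y P p q" "u \<in> hom C N P" "v \<in> hom C N P"
    "p \<cdot> u = p \<cdot> v" "q \<cdot> u = q \<cdot> v"
  shows "u = v"
proof -
  have "p \<cdot> v \<in> hom C N X" "q \<cdot> v \<in> hom C N Y"
    using assms(1) Cmp_hom[OF assms(3)] by (auto simp: is_product_def)
  then have "\<exists>!h. h \<in> hom C N P \<and> p \<cdot> h = p \<cdot> v \<and> q \<cdot> h = q \<cdot> v"
    using assms(1) unfolding is_product_def by blast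
  then show ?thesis using assms(2-5) by blast
qed

lemma product_mapE:
  assumes "is_product C X Y P p q" "a \<in> hom C N X" "b \<in> hom C N Y"
  obtains h where "h \<in> hom C N P" "p \<cdot> h = a" "q \<cdot> h = b"
  using assms unfolding is_product_def by blast

lemma pullback_mapE:
  assumes "is_pullback C f g p q" "a \<in> hom C N (Dom C f)" "b \<in> hom C N (Dom C g)"
    "f \<cdot> a = g \<cdot> b"
  obtains h where "h \<in> hom C N (Dom C p)" "p \<cdot> h = a" "q \<cdot> h = b"
  using assms unfolding is_pullback_def by blast

lemma pullbackD:
  assumes "is_pullback C f g p q"
  shows "p \<in> hom C (Dom C p) (Dom C f)" "q \<in> hom C (Dom C p) (Dom C g)" "f \<cdot> p = g \<cdot> q"
  using assms by (simp_all add: is_pullback_def)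

end


section \<open>Path components of cocycles as a functor of the target\<close>

text \<open>Composing the members of a component with \<open>f\<close> need not fill a whole
  component of the new cocycle category; taking the image under \<open>connected_rel\<close>
  completes it without choosing a representative.\<close>

definition pi0_push ::
  "('o, 'm) category \<Rightarrow> 'm set \<Rightarrow> 'o \<Rightarrow> 'm \<Rightarrow> ('m \<times> 'm) set \<Rightarrow> ('m \<times> 'm) set" where
  "pi0_push C W X f K =
     connected_rel (cocycles C W X (Cod C f)) `` ((\<lambda>(a, b). (a, f \<cdot>\<^bsub>C\<^esub> b)) ` K)"

lemma equiv_connected_rel: "equiv (Ob C) (connected_rel C)"
  unfolding connected_rel_def by (rule equiv_gen_equiv)

lemma connected_rel_refl: "c \<in> Ob C \<Longrightarrow> (c, c) \<in> connected_rel C"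
  by (simp add: connected_rel_def gen_equiv_def)

lemma connected_rel_sym: "(c, d) \<in> connected_rel C \<Longrightarrow> (d, c) \<in> connected_rel C"
  by (meson equivE equiv_connected_rel symD)

lemma connected_rel_trans:
  "\<lbrakk>(c, d) \<in> connected_rel C; (d, e) \<in> connected_rel C\<rbrakk> \<Longrightarrow> (c, e) \<in> connected_rel C"
  by (meson equivE equiv_connected_rel transD)

lemma path_component_eq_iff:
  "\<lbrakk>c \<in> Ob C; d \<in> Ob C\<rbrakk>
     \<Longrightarrow> path_component C c = path_component C d \<longleftrightarrow> (c, d) \<in> connected_rel C"
  unfolding path_component_def by (rule eq_equiv_class_iff[OF equiv_connected_rel])

lemma path_component_pi0: "c \<in> Ob C \<Longrightarrow> path_component C c \<in> pi0 C"
  unfolding path_component_def pi0_def by (rule quotientI)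

lemma pi0E:
  assumes "K \<in> pi0 C" obtains c where "c \<in> Ob C" "K = path_component C c"
  using assms unfolding path_component_def pi0_def by (auto elim: quotientE)

section \<open>Composition of cocycles with an arrow out of the target\<close>

context category
begin

lemma connected_cocyclesI:
  assumes "(f, g) \<in> Ob (cocycles C W X Y)" "(f', g') \<in> Ob (cocycles C W X Y)"
    "\<alpha> \<in> hom C (Dom C f) (Dom C f')" "f' \<cdot> \<alpha> = f" "g' \<cdot> \<alpha> = g"
  shows "((f, g), (f', g')) \<in> connected_rel (cocycles C W X Y)"
proof -
  have "((f, g), \<alpha>, (f', g')) \<in> hom (cocycles C W X Y) (f, g) (f', g')"
    using assms by (simp only: cocycle_hom; blast)
  then show ?thesis
    unfolding connected_rel_def using assms(1,2) by (intro gen_equiv_base) auto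
qed

lemma push_cocycle_Ob:
  assumes "(f, g) \<in> Ob (cocycles C W X Y)" "h \<in> hom C Y Z"
  shows "(f, h \<cdot> g) \<in> Ob (cocycles C W X Z)"
  using assms Cmp_hom[OF _ assms(2)] unfolding cocycle_Ob by blast

text \<open>The same \<alpha> is a morphism between the composed cocycles, since
  \<open>h \<cdot> g' \<cdot> \<alpha> = h \<cdot> g\<close>; induction over the generated
  equivalence does the rest.\<close>

lemma push_cocycle_connected:
  assumes h: "h \<in> hom C Y Z" and "(c, d) \<in> connected_rel (cocycles C W X Y)"
  shows "((fst c, h \<cdot> snd c), (fst d, h \<cdot> snd d)) \<in> connected_rel (cocycles C W X Z)"
    (is "(?p c, ?p d) \<in> _")
proof -
  have pOb: "?p c \<in> Ob (cocycles C W X Z)" if "c \<in> Ob (cocycles C W X Y)" for c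
    using that push_cocycle_Ob[OF _ h, of "fst c" "snd c"] by simp
  show ?thesis
    using assms(2) unfolding connected_rel_def[of "cocycles C W X Y"]
  proof (induction rule: gen_equiv_induct)
    case (rel c d)
    then obtain a where "a \<in> hom (cocycles C W X Y) c d" by auto
    then obtain f g \<alpha> f' g' where 1: "c = (f, g)" "d = (f', g')"
      "(f, g) \<in> Ob (cocycles C W X Y)" "(f', g') \<in> Ob (cocycles C W X Y)"
      "\<alpha> \<in> hom C (Dom C f) (Dom C f')" "f' \<cdot> \<alpha> = f" "g' \<cdot> \<alpha> = g"
      by (rule cocycle_homE)
    have "g' \<in> hom C (Dom C f') Y" using 1(4) unfolding cocycle_Ob by blast
    then have "h \<cdot> g' \<cdot> \<alpha> = h \<cdot> g" using Cmp_assoc[OF 1(5) _ h] 1(7) by metis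
    then show ?case
      using connected_cocyclesI[of f "h \<cdot> g" W X Z f' "h \<cdot> g'" \<alpha>] 1(1,2,5,6)
        pOb[OF rel(1)] pOb[OF rel(2)] by simp
  next
    case (refl c)
    then show ?case by (rule connected_rel_refl[OF pOb])
  next
    case (sym c d)
    then show ?case by (rule connected_rel_sym)
  next
    case (trans c d e)
    then show ?case by (rule connected_rel_trans)
  qed
qed

text \<open>By \<open>push_cocycle_connected\<close> all members of the component land in one class,
  so the union behind \<open>pi0_push\<close> collapses to that class.\<close>

lemma pi0_push_path_component:
  assumes c: "(f, g) \<in> Ob (cocycles C W X Y)" and h: "h \<in> hom C Y Z"
  shows "pi0_push C W X h (path_component (cocycles C W X Y) (f, g)) =
    path_component (cocycles C W X Z) (f, h \<cdot> g)"
proof -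
  let ?K = "path_component (cocycles C W X Y) (f, g)" and ?R = "connected_rel (cocycles C W X Z)"
  have "(f, g) \<in> ?K" using connected_rel_refl[OF c] by (simp add: path_component_def)
  moreover have "?R `` {(fst d, h \<cdot> snd d)} = ?R `` {(f, h \<cdot> g)}" if "d \<in> ?K" for d
    using that push_cocycle_connected[OF h, of "(f, g)" d W X]
      equiv_class_eq[OF equiv_connected_rel, of "(f, h \<cdot> g)"]
    by (auto simp: path_component_def)
  ultimately have "(\<Union>d\<in>?K. ?R `` {(fst d, h \<cdot> snd d)}) = ?R `` {(f, h \<cdot> g)}" by blast
  moreover have "pi0_push C W X h ?K = (\<Union>d\<in>?K. ?R `` {(fst d, h \<cdot> snd d)})"
    unfolding pi0_push_def homD(3)[OF h] split_def by (subst Image_eq_UN) simp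
  ultimately show ?thesis by (simp add: path_component_def[of "cocycles C W X Z"])
qed

lemma pi0_cocyclesE:
  assumes "K \<in> pi0 (cocycles C W X Y)"
  obtains f g where "(f, g) \<in> Ob (cocycles C W X Y)"
    "f \<in> W" "f \<in> hom C (Dom C f) X" "g \<in> hom C (Dom C f) Y"
    "K = path_component (cocycles C W X Y) (f, g)"
proof -
  obtain c where "c \<in> Ob (cocycles C W X Y)" "K = path_component (cocycles C W X Y) c"
    using assms by (rule pi0E)
  moreover obtain f g where "c = (f, g)" by (cases c)
  ultimately show ?thesis using that[of f g] cocycle_Ob[of f g W X Y] by simp
qed

lemma pi0_push_in:
  assumes "K \<in> pi0 (cocycles C W X Y)" "h \<in> hom C Y Z"
  shows "pi0_push C W X h K \<in> pi0 (cocycles C W X Z)"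
  using assms(1)
  by (rule pi0_cocyclesE)
    (simp add: pi0_push_path_component[OF _ assms(2)] push_cocycle_Ob[OF _ assms(2)] path_component_pi0)

lemma pi0_push_Idt:
  assumes "K \<in> pi0 (cocycles C W X Y)"
  shows "pi0_push C W X (Idt C Y) K = K"
  using assms
proof (rule pi0_cocyclesE)
  fix f g assume *: "(f, g) \<in> Ob (cocycles C W X Y)" "g \<in> hom C (Dom C f) Y"
    "K = path_component (cocycles C W X Y) (f, g)"
  show ?thesis
    using pi0_push_path_component[OF *(1) Idt_hom[OF hom_Ob(2)[OF *(2)]]] Idt_left[OF *(2)] *(3)
    by simp
qed

lemma pi0_push_Cmp:
  assumes "K \<in> pi0 (cocycles C W X Y)" and h: "h \<in> hom C Y Z" and k: "k \<in> hom C Z T"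
  shows "pi0_push C W X (k \<cdot> h) K = pi0_push C W X k (pi0_push C W X h K)"
  using assms(1)
proof (rule pi0_cocyclesE)
  fix f g assume *: "(f, g) \<in> Ob (cocycles C W X Y)" "g \<in> hom C (Dom C f) Y"
    "K = path_component (cocycles C W X Y) (f, g)"
  show ?thesis
    using pi0_push_path_component[OF *(1) Cmp_hom[OF h k]] pi0_push_path_component[OF *(1) h]
      pi0_push_path_component[OF push_cocycle_Ob[OF *(1) h] k] Cmp_assoc[OF *(2) h k] *(3)
    by simp
qed

end

text \<open>Objects are all subsets of one type. Functions are extensional, so that arrows are equal
  as soon as they agree on their domain; the triples keep source and target recoverable.\<close>

definition set_category :: "('a set, 'a set \<times> ('a \<Rightarrow> 'a) \<times> 'a set) category" where
  "set_category =
     \<lparr>Ob = UNIV, Ar = {(A, F, B). F \<in> A \<rightarrow>\<^sub>E B}, Dom = (\<lambda>(A, F, B). A), Cod = (\<lambda>(A, F, B). B),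
      Idt = (\<lambda>A. (A, \<lambda>x\<in>A. x, A)),
      Cmp = (\<lambda>(B, G, D) (A, F, B'). (A, compose A G F, D))\<rparr>"

lemma set_category_hom: "u \<in> hom set_category A B \<longleftrightarrow> (\<exists>F \<in> A \<rightarrow>\<^sub>E B. u = (A, F, B))"
  by (auto simp: hom_def set_category_def)

lemma set_category_Cmp:
  "(B', G, D) \<cdot>\<^bsub>set_category\<^esub> (A, F, B) = (A, compose A G F, D)"
  by (simp add: set_category_def)

lemma set_category_Idt: "Idt set_category A = (A, \<lambda>x\<in>A. x, A)"
  by (simp add: set_category_def)

lemma category_set_category: "category set_category"
proof
  fix f g h :: "'a set \<times> ('a \<Rightarrow> 'a) \<times> 'a set" and X Y Z T :: "'a set"
  {
    assume "f \<in> hom set_category X Y" "g \<in> hom set_category Y Z" "h \<in> hom set_category Z T"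
    then show "h \<cdot>\<^bsub>set_category\<^esub> (g \<cdot>\<^bsub>set_category\<^esub> f) =
        h \<cdot>\<^bsub>set_category\<^esub> g \<cdot>\<^bsub>set_category\<^esub> f"
      by (auto simp: set_category_hom set_category_Cmp compose_def fun_eq_iff PiE_iff)
  next
    assume "f \<in> hom set_category X Y"
    then show "f \<cdot>\<^bsub>set_category\<^esub> Idt set_category X = f"
      "Idt set_category Y \<cdot>\<^bsub>set_category\<^esub> f = f"
      by (auto simp: set_category_hom set_category_Cmp set_category_Idt compose_def fun_eq_iff
          PiE_iff extensional_def)
  next
    assume "f \<in> hom set_category X Y" "g \<in> hom set_category Y Z"
    then show "g \<cdot>\<^bsub>set_category\<^esub> f \<in> hom set_category X Z"
      by (auto simp: set_category_hom set_category_Cmp compose_def PiE_iff)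
  }
qed (auto simp: set_category_def hom_def)

lemma is_iso_set_category:
  assumes "F \<in> A \<rightarrow>\<^sub>E B" "bij_betw F A B"
  shows "is_iso set_category (A, F, B)"
proof -
  let ?G = "\<lambda>y\<in>B. inv_into A F y"
  have "?G \<in> B \<rightarrow>\<^sub>E A" using bij_betw_inv_into[OF assms(2)] by (auto simp: bij_betw_def)
  then have "inverse_arrows set_category (A, F, B) (B, ?G, A)"
    using assms bij_betw_inv_into_left[OF assms(2)] bij_betw_inv_into_right[OF assms(2)]
    by (auto simp: inverse_arrows_def set_category_def hom_def compose_def PiE_iff
        intro!: restrict_ext)
  then show ?thesis unfolding is_iso_def by blast
qed

definition pi0_push_arrow where
  "pi0_push_arrow C W X f =
     (pi0 (cocycles C W X (Dom C f)),
      restrict (pi0_push C W X f) (pi0 (cocycles C W X (Dom C f))),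
      pi0 (cocycles C W X (Cod C f)))"

context category
begin

lemma functor_pi0_push:
  "is_functor C set_category (\<lambda>Y. pi0 (cocycles C W X Y)) (pi0_push_arrow C W X)"
  unfolding is_functor_def
proof (intro conjI ballI impI)
  fix Y assume "Y \<in> Ob C"
  then have "Dom C (Idt C Y) = Y" "Cod C (Idt C Y) = Y"
    using Idt_hom[of Y] by (simp_all add: hom_def)
  then show "pi0_push_arrow C W X (Idt C Y) = Idt set_category (pi0 (cocycles C W X Y))"
    by (auto simp: pi0_push_arrow_def set_category_Idt pi0_push_Idt intro!: restrict_ext)
next
  fix f assume "f \<in> Ar C"
  then show "pi0_push_arrow C W X f \<in>
      hom set_category (pi0 (cocycles C W X (Dom C f))) (pi0 (cocycles C W X (Cod C f)))"
    using pi0_push_in[OF _ homI[of f C]] by (auto simp: pi0_push_arrow_def set_category_hom)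
next
  fix f g assume "f \<in> Ar C" "g \<in> Ar C" "Cod C f = Dom C g"
  then have f: "f \<in> hom C (Dom C f) (Dom C g)" and g: "g \<in> hom C (Dom C g) (Cod C g)"
    by (auto intro: homI)
  then have "Dom C (g \<cdot> f) = Dom C f" "Cod C (g \<cdot> f) = Cod C g"
    using homD[OF Cmp_hom[OF f g]] by simp_all
  then show "pi0_push_arrow C W X (g \<cdot> f) =
      pi0_push_arrow C W X g \<cdot>\<^bsub>set_category\<^esub> pi0_push_arrow C W X f"
    using pi0_push_Cmp[OF _ f g] pi0_push_in[OF _ f]
    by (auto simp: pi0_push_arrow_def set_category_Cmp compose_def intro!: restrict_ext)
qed (simp add: set_category_def)

end


section \<open>Weak equivalences act bijectively\<close>

context closed_model_category
begin

lemma W_Cmp: "\<lbrakk>f \<in> W; g \<in> W; f \<in> hom M X Y; g \<in> hom M Y Z\<rbrakk> \<Longrightarrow> g \<cdot> f \<in> W"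
  using CM2 by (auto simp: two_out_of_three_def hom_def)

lemma W_cancel_right: "\<lbrakk>f \<in> W; g \<cdot> f \<in> W; f \<in> hom M X Y; g \<in> hom M Y Z\<rbrakk> \<Longrightarrow> g \<in> W"
  using CM2 by (auto simp: two_out_of_three_def hom_def)

text \<open>This is not among the axioms. Factoring the identity yields a weak equivalence
  \<open>p\<close> into \<open>X\<close>; as \<open>1 \<cdot> p = p\<close>, two out of three gives
  the claim.\<close>

lemma Idt_W: assumes "X \<in> Ob M" shows "Idt M X \<in> W"
proof -
  have I: "Idt M X \<in> hom M X X" using Idt_hom[OF assms] .
  obtain i p where ip: "i \<in> Cof" "p \<in> Fib \<inter> W" "Cod M i = Dom M p" "Idt M X = p \<cdot> i"
    using CM5(1) homD(1)[OF I] unfolding has_factorization_def by meson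
  have i: "i \<in> hom M (Dom M i) (Dom M p)" and p: "p \<in> hom M (Dom M p) (Cod M p)"
    using ip Cof_Ar Fib_Ar by (auto simp: hom_def)
  have "Cod M p = X" using homD(3)[OF I] homD(3)[OF Cmp_hom[OF i p]] ip(4) by simp
  then have p: "p \<in> hom M (Dom M p) X" using p by simp
  show ?thesis using W_cancel_right[OF _ _ p I] Idt_left[OF p] ip(2) by simp
qed

end

text \<open>Here \<open>k\<close> is \<open>w \<times> 1\<close> between the products of
  \<open>Y\<close> and \<open>Y'\<close> with \<open>X\<close>; \<open>b\<close>, \<open>b'\<close>
  project to the targets and \<open>a\<close>, \<open>a'\<close> to the common source
  \<open>X\<close>.\<close>

locale weak_equivalence_product = closed_model_category M W Fib Cof
  for M :: "('o, 'm) category" (structure) and W Fib Cof +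
  fixes X Y Y' P Q :: 'o and w a b a' b' k :: 'm
  assumes proper: "right_proper M W Fib"
    and P: "is_product M Y X P b a" and Q: "is_product M Y' X Q b' a'"
    and w: "w \<in> hom M Y Y'"
    and k: "k \<in> hom M P Q" "k \<in> W" "a' \<cdot> k = a" "b' \<cdot> k = w \<cdot> b"
begin

abbreviation "H \<equiv> cocycles M W X Y"
abbreviation "H' \<equiv> cocycles M W X Y'"

lemma projections:
  "a \<in> hom M P X" "b \<in> hom M P Y" "a' \<in> hom M Q X" "b' \<in> hom M Q Y'"
  using P Q by (simp_all add: is_product_def)

text \<open>\<open>d\<close> arises from \<open>c\<close>, viewed as an arrow \<open>p \<cdot> j\<close> to \<open>Q = Y' \<times> X\<close>, by pulling
  the fibration \<open>p\<close> back along \<open>k = w \<times> 1\<close>.\<close>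

definition pulled_back :: "'m \<times> 'm \<Rightarrow> 'm \<times> 'm \<Rightarrow> bool" where
  "pulled_back c d \<longleftrightarrow>
     (\<exists>Z V U j p q t. j \<in> Cof \<inter> W \<and> p \<in> Fib \<and> is_pullback M k p q t \<and>
        j \<in> hom M Z V \<and> p \<in> hom M V Q \<and> q \<in> hom M U P \<and> t \<in> hom M U V \<and>
        c = (a' \<cdot> (p \<cdot> j), b' \<cdot> (p \<cdot> j)) \<and> d = (a \<cdot> q, b \<cdot> q))"

lemma pulled_backE:
  assumes "pulled_back c d"
  obtains Z V U j p q t where "j \<in> Cof" "j \<in> W" "p \<in> Fib" "is_pullback M k p q t"
    "j \<in> hom M Z V" "p \<in> hom M V Q" "q \<in> hom M U P" "t \<in> hom M U V" "k \<cdot> q = p \<cdot> t"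
    "c = (a' \<cdot> (p \<cdot> j), b' \<cdot> (p \<cdot> j))" "d = (a \<cdot> q, b \<cdot> q)"
  using assms unfolding pulled_back_def by (elim exE conjE) (blast dest: pullbackD(3))

text \<open>Since \<open>j\<close> and \<open>a' \<cdot> p \<cdot> j\<close> are weak equivalences,
  so is \<open>a' \<cdot> p\<close>; right properness makes \<open>t\<close> one, hence also
  \<open>a \<cdot> q = a' \<cdot> p \<cdot> t\<close>. The path passes through
  \<open>(a' \<cdot> p, b' \<cdot> p)\<close>: \<open>t\<close> maps the pushed forward
  \<open>d\<close> to it, and \<open>j\<close> maps \<open>c\<close> to it.\<close>

lemma pulled_back_Ob:
  assumes "c \<in> Ob H'" "pulled_back c d"
  shows "d \<in> Ob H" "((fst d, w \<cdot> snd d), c) \<in> connected_rel H'"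
proof -
  obtain Z V U j p q t where j: "j \<in> W" "j \<in> hom M Z V" and p: "p \<in> Fib" "p \<in> hom M V Q"
    and q: "q \<in> hom M U P" and t: "t \<in> hom M U V" and pb: "is_pullback M k p q t"
    and kq: "k \<cdot> q = p \<cdot> t"
    and c: "c = (a' \<cdot> (p \<cdot> j), b' \<cdot> (p \<cdot> j))" and d: "d = (a \<cdot> q, b \<cdot> q)"
    using assms(2) by (rule pulled_backE) blast
  note [simp] = projections
  have ap: "a' \<cdot> p \<in> hom M V X" and bp: "b' \<cdot> p \<in> hom M V Y'"
    and aq: "a \<cdot> q \<in> hom M U X" and bq: "b \<cdot> q \<in> hom M U Y"
    using Cmp_hom[OF p(2), of a'] Cmp_hom[OF p(2), of b'] Cmp_hom[OF q, of a] Cmp_hom[OF q, of b]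
    by simp_all
  have assoc: "a' \<cdot> (p \<cdot> j) = a' \<cdot> p \<cdot> j" "b' \<cdot> (p \<cdot> j) = b' \<cdot> p \<cdot> j"
    using Cmp_assoc[OF j(2) p(2) projections(3)] Cmp_assoc[OF j(2) p(2) projections(4)] .
  have "a' \<cdot> p \<cdot> j \<in> W" using assms(1) unfolding c assoc(1)[symmetric] cocycle_Ob by blast
  then have apW: "a' \<cdot> p \<in> W" by (rule W_cancel_right[OF j(1) _ j(2) ap])
  have tW: "t \<in> W" using proper pb p(1) k(2) unfolding right_proper_def by blast
  have aqt: "a \<cdot> q = a' \<cdot> p \<cdot> t" and bqt: "w \<cdot> (b \<cdot> q) = b' \<cdot> p \<cdot> t"
    using Cmp_assoc[OF q k(1) projections(3)] Cmp_assoc[OF q k(1) projections(4)]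
      Cmp_assoc[OF q projections(2) w] Cmp_assoc[OF t p(2) projections(3)]
      Cmp_assoc[OF t p(2) projections(4)] k(3,4) kq by simp_all
  have "a \<cdot> q \<in> W" unfolding aqt by (rule W_Cmp[OF tW apW t ap])
  then show dOb: "d \<in> Ob H" unfolding d cocycle_Ob using aq bq homD(2)[OF aq] by simp
  have mid: "(a' \<cdot> p, b' \<cdot> p) \<in> Ob H'"
    unfolding cocycle_Ob using apW ap bp homD(2)[OF ap] by simp
  have wd: "(a \<cdot> q, w \<cdot> (b \<cdot> q)) \<in> Ob H'" using push_cocycle_Ob[OF _ w] dOb d by blast
  have "((a \<cdot> q, w \<cdot> (b \<cdot> q)), (a' \<cdot> p, b' \<cdot> p)) \<in> connected_rel H'"
    using t homD(2)[OF aq] homD(2)[OF ap] aqt bqt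
    by (intro connected_cocyclesI[OF wd mid, of t]) simp_all
  moreover have "(c, (a' \<cdot> p, b' \<cdot> p)) \<in> connected_rel H'"
    using assms(1) j(2) homD(2)[OF Cmp_hom[OF j(2) ap]] homD(2)[OF ap] unfolding c assoc
    by (intro connected_cocyclesI[OF _ mid, of _ _ j]) simp_all
  ultimately show "((fst d, w \<cdot> snd d), c) \<in> connected_rel H'"
    unfolding d by (auto intro: connected_rel_trans connected_rel_sym)
qed

lemma ex_pulled_back:
  assumes "c \<in> Ob H'" obtains d where "pulled_back c d"
proof -
  obtain f g where c: "c = (f, g)" by (cases c)
  define Z where "Z = Dom M f"
  have f: "f \<in> hom M Z X" and g: "g \<in> hom M Z Y'"
    using assms unfolding c cocycle_Ob Z_def by blast+
  \<comment> \<open>The cocycle as a single arrow to the product, ready to be factored by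
    CM5.\<close>
  obtain h where h: "h \<in> hom M Z Q" "b' \<cdot> h = g" "a' \<cdot> h = f"
    using product_mapE[OF Q g f] by blast
  obtain j p where jp: "j \<in> Cof \<inter> W" "p \<in> Fib" "Cod M j = Dom M p" "h = p \<cdot> j"
    using CM5(2) homD(1)[OF h(1)] unfolding has_factorization_def by meson
  define V where "V = Dom M p"
  have j: "j \<in> hom M (Dom M j) V" and p: "p \<in> hom M V (Cod M p)"
    using jp Cof_Ar Fib_Ar by (auto simp: hom_def V_def)
  have "Dom M j = Z" "Cod M p = Q" using Cmp_hom[OF j p] h(1) jp(4) by (auto simp: hom_def)
  then have j: "j \<in> hom M Z V" and p: "p \<in> hom M V Q" using j p by simp_all
  obtain q t where pb: "is_pullback M k p q t" using ex_pullback[OF CM1(1) k(1) p] .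
  have "q \<in> hom M (Dom M q) P" "t \<in> hom M (Dom M q) V"
    using pullbackD(1,2)[OF pb] homD(2)[OF k(1)] homD(2)[OF p] by simp_all
  then have "pulled_back c (a \<cdot> q, b \<cdot> q)"
    unfolding pulled_back_def using jp(1,2) pb j p h(2,3) jp(4) c by blast
  then show ?thesis by (rule that)
qed

text \<open>The lift in the square with sides \<open>j\<close> and \<open>p'\<close> induces a map of pullbacks; for
  \<open>\<alpha> = 1\<close> this shows that the component does not depend on the factorization.\<close>

lemma pulled_back_morphism:
  assumes fg: "(f, g) \<in> Ob H'" "(f', g') \<in> Ob H'"
    and \<alpha>: "\<alpha> \<in> hom M (Dom M f) (Dom M f')" "f' \<cdot> \<alpha> = f" "g' \<cdot> \<alpha> = g"
    and d: "pulled_back (f, g) d" and d': "pulled_back (f', g') d'"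
  shows "(d, d') \<in> connected_rel H"
proof -
  obtain Z V U j p q t where j: "j \<in> Cof" "j \<in> W" "j \<in> hom M Z V"
    and p: "p \<in> hom M V Q" and q: "q \<in> hom M U P" and t: "t \<in> hom M U V"
    and kq: "k \<cdot> q = p \<cdot> t"
    and "(f, g) = (a' \<cdot> (p \<cdot> j), b' \<cdot> (p \<cdot> j))" and dq: "d = (a \<cdot> q, b \<cdot> q)"
    using d by (rule pulled_backE) blast
  then have f: "f = a' \<cdot> (p \<cdot> j)" and g: "g = b' \<cdot> (p \<cdot> j)" by simp_all
  obtain Z' V' U' j' p' q' t' where j': "j' \<in> hom M Z' V'"
    and p': "p' \<in> Fib" "p' \<in> hom M V' Q" and q': "q' \<in> hom M U' P" and t': "t' \<in> hom M U' V'"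
    and pb': "is_pullback M k p' q' t'"
    and "(f', g') = (a' \<cdot> (p' \<cdot> j'), b' \<cdot> (p' \<cdot> j'))" and dq': "d' = (a \<cdot> q', b \<cdot> q')"
    using d' by (rule pulled_backE) blast
  then have f': "f' = a' \<cdot> (p' \<cdot> j')" and g': "g' = b' \<cdot> (p' \<cdot> j')" by simp_all
  note pj = Cmp_hom[OF j(3) p] and pj' = Cmp_hom[OF j' p'(2)]
  have "Dom M f = Z" "Dom M f' = Z'"
    using homD(2)[OF Cmp_hom[OF pj projections(3)]] homD(2)[OF Cmp_hom[OF pj' projections(3)]]
    by (simp_all add: f f')
  then have \<alpha>h: "\<alpha> \<in> hom M Z Z'" using \<alpha>(1) by simp
  \<comment> \<open>Both sides have components \<open>f\<close> and \<open>g\<close>. So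
    \<open>j' \<cdot> \<alpha>\<close> and \<open>p\<close> form a commutative square from
    \<open>j\<close> to \<open>p'\<close>, to which lifting applies.\<close>
  have "p' \<cdot> j' \<cdot> \<alpha> = p \<cdot> j"
  proof (rule product_map_eqI[OF Q Cmp_hom[OF \<alpha>h pj'] pj])
    show "b' \<cdot> (p' \<cdot> j' \<cdot> \<alpha>) = b' \<cdot> (p \<cdot> j)"
      using Cmp_assoc[OF \<alpha>h pj' projections(4)] \<alpha>(3) by (simp add: g g')
    show "a' \<cdot> (p' \<cdot> j' \<cdot> \<alpha>) = a' \<cdot> (p \<cdot> j)"
      using Cmp_assoc[OF \<alpha>h pj' projections(3)] \<alpha>(2) by (simp add: f f')
  qed
  then have "p' \<cdot> (j' \<cdot> \<alpha>) = p \<cdot> j" using Cmp_assoc[OF \<alpha>h j' p'(2)] by simp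
  moreover have "has_lifting M j p'" using CM4 j p'(1) by blast
  ultimately obtain h where h: "h \<in> hom M V V'" "p' \<cdot> h = p"
    using Cmp_hom[OF \<alpha>h j'] p homD[OF j(3)] homD[OF p'(2)] unfolding has_lifting_def by metis
  have "k \<cdot> q = p' \<cdot> (h \<cdot> t)" using kq h(2) Cmp_assoc[OF t h(1) p'(2)] by simp
  \<comment> \<open>The map of pullbacks with components \<open>q\<close> and
    \<open>h \<cdot> t\<close>; it is the required morphism from \<open>d\<close> to
    \<open>d'\<close>.\<close>
  then obtain m where m: "m \<in> hom M U U'" "q' \<cdot> m = q"
    using pullback_mapE[OF pb', of q U "h \<cdot> t"] q Cmp_hom[OF t h(1)] homD(2)[OF k(1)]
      homD(2)[OF p'(2)] homD(2)[OF q'] by metis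
  have "a \<cdot> q' \<cdot> m = a \<cdot> q" "b \<cdot> q' \<cdot> m = b \<cdot> q"
    using Cmp_assoc[OF m(1) q' projections(1)] Cmp_assoc[OF m(1) q' projections(2)] m(2) by simp_all
  moreover have "Dom M (a \<cdot> q) = U" "Dom M (a \<cdot> q') = U'"
    using homD(2)[OF Cmp_hom[OF q projections(1)]] homD(2)[OF Cmp_hom[OF q' projections(1)]] .
  ultimately show ?thesis
    using pulled_back_Ob(1)[OF fg(1) d] pulled_back_Ob(1)[OF fg(2) d'] m(1) unfolding dq dq'
    by (intro connected_cocyclesI[of _ _ _ _ _ _ _ m]) simp_all
qed

lemma pulled_back_connected:
  assumes "(c, c') \<in> connected_rel H'" "pulled_back c d" "pulled_back c' d'"
  shows "(d, d') \<in> connected_rel H"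
proof -
  \<comment> \<open>The induction carries membership in \<open>Ob H'\<close> because transitivity
    has to pull back the intermediate cocycle. Reflexivity has content too: \<open>d\<close> and
    \<open>d'\<close> may stem from different factorizations of one cocycle.\<close>
  have "c \<in> Ob H' \<and> c' \<in> Ob H' \<and>
      (\<forall>d d'. pulled_back c d \<longrightarrow> pulled_back c' d' \<longrightarrow> (d, d') \<in> connected_rel H)"
    using assms(1) unfolding connected_rel_def[of H']
  proof (induction rule: gen_equiv_induct)
    case (rel c c')
    then obtain \<alpha> where "\<alpha> \<in> hom H' c c'" by auto
    then obtain f g \<beta> f' g' where "c = (f, g)" "c' = (f', g')"
      "\<beta> \<in> hom M (Dom M f) (Dom M f')" "f' \<cdot> \<beta> = f" "g' \<cdot> \<beta> = g"
      by (rule cocycle_homE)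
    then show ?case using rel(1,2) pulled_back_morphism by metis
  next
    case (refl c)
    obtain f g where c: "c = (f, g)" by (cases c)
    then have "f \<in> hom M (Dom M f) X" "g \<in> hom M (Dom M f) Y'"
      using refl unfolding c cocycle_Ob by blast+
    then have "f \<cdot> Idt M (Dom M f) = f" "g \<cdot> Idt M (Dom M f) = g"
      "Idt M (Dom M f) \<in> hom M (Dom M f) (Dom M f)"
      using Idt_right Idt_hom hom_Ob by simp_all
    then show ?case using refl pulled_back_morphism c by metis
  next
    case (sym c c')
    then show ?case using connected_rel_sym by metis
  next
    case (trans c c' c'')
    then obtain e where "pulled_back c' e" using ex_pulled_back by metis
    then show ?case using trans connected_rel_trans by metis
  qed
  then show ?thesis using assms(2,3) by blast
qed

text \<open>The arrow to \<open>Q\<close> given by \<open>(f, w \<cdot> g)\<close> factors as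
  \<open>k \<cdot> e\<close> with \<open>e\<close> the arrow to \<open>P\<close> given by
  \<open>(f, g)\<close>. Thus \<open>e\<close> and \<open>j\<close> induce a map into the pullback,
  which is a morphism from \<open>(f, g)\<close> to \<open>d\<close>.\<close>

lemma pulled_back_push:
  assumes fg: "(f, g) \<in> Ob H" and d: "pulled_back (f, w \<cdot> g) d"
  shows "((f, g), d) \<in> connected_rel H"
proof -
  obtain Z V U j p q t where j: "j \<in> hom M Z V"
    and p: "p \<in> hom M V Q" and q: "q \<in> hom M U P" and pb: "is_pullback M k p q t"
    and "(f, w \<cdot> g) = (a' \<cdot> (p \<cdot> j), b' \<cdot> (p \<cdot> j))" and dq: "d = (a \<cdot> q, b \<cdot> q)"
    using d by (rule pulled_backE) blast
  then have fj: "f = a' \<cdot> (p \<cdot> j)" and gj: "w \<cdot> g = b' \<cdot> (p \<cdot> j)" by simp_all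
  note pj = Cmp_hom[OF j p]
  have Z: "Dom M f = Z" using homD(2)[OF Cmp_hom[OF pj projections(3)]] by (simp add: fj)
  have f: "f \<in> hom M Z X" and g: "g \<in> hom M Z Y"
    using fg unfolding cocycle_Ob Z by blast+
  obtain e where e: "e \<in> hom M Z P" "b \<cdot> e = g" "a \<cdot> e = f"
    using product_mapE[OF P g f] by blast
  have "k \<cdot> e = p \<cdot> j"
  proof (rule product_map_eqI[OF Q Cmp_hom[OF e(1) k(1)] pj])
    show "b' \<cdot> (k \<cdot> e) = b' \<cdot> (p \<cdot> j)"
      using Cmp_assoc[OF e(1) k(1) projections(4)] Cmp_assoc[OF e(1) projections(2) w] k(4) e(2) gj
      by simp
    show "a' \<cdot> (k \<cdot> e) = a' \<cdot> (p \<cdot> j)"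
      using Cmp_assoc[OF e(1) k(1) projections(3)] k(3) e(3) fj by simp
  qed
  then obtain m where m: "m \<in> hom M Z U" "q \<cdot> m = e"
    using pullback_mapE[OF pb, of e Z j] e(1) j homD(2)[OF k(1)] homD(2)[OF p] homD(2)[OF q]
    by metis
  have "a \<cdot> q \<cdot> m = f" "b \<cdot> q \<cdot> m = g"
    using Cmp_assoc[OF m(1) q projections(1)] Cmp_assoc[OF m(1) q projections(2)] m(2) e by simp_all
  moreover have "Dom M (a \<cdot> q) = U" using homD(2)[OF Cmp_hom[OF q projections(1)]] .
  moreover have "d \<in> Ob H" using pulled_back_Ob(1)[OF push_cocycle_Ob[OF fg w] d] .
  ultimately show ?thesis
    using fg m(1) Z unfolding dq by (intro connected_cocyclesI[of _ _ _ _ _ _ _ m]) simp_all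
qed

text \<open>Pulling back is inverse to pushing along \<open>w\<close>:
  \<open>pulled_back_push\<close> gives injectivity, the second part of
  \<open>pulled_back_Ob\<close> surjectivity.\<close>

lemma bij_betw_pi0_push: "bij_betw (pi0_push M W X w) (pi0 H) (pi0 H')"
proof (rule bij_betw_imageI[OF inj_onI])
  fix K K' assume "K \<in> pi0 H" "K' \<in> pi0 H" and eq: "pi0_push M W X w K = pi0_push M W X w K'"
  then obtain f g f' g' where fg: "(f, g) \<in> Ob H" "(f', g') \<in> Ob H"
    and K: "K = path_component H (f, g)" "K' = path_component H (f', g')"
    by (elim pi0_cocyclesE) blast
  note push = push_cocycle_Ob[OF fg(1) w] push_cocycle_Ob[OF fg(2) w]
  have "path_component H' (f, w \<cdot> g) = path_component H' (f', w \<cdot> g')"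
    using eq K pi0_push_path_component[OF fg(1) w] pi0_push_path_component[OF fg(2) w] by simp
  then have c: "((f, w \<cdot> g), (f', w \<cdot> g')) \<in> connected_rel H'"
    using path_component_eq_iff[OF push] by simp
  obtain d d' where d: "pulled_back (f, w \<cdot> g) d" "pulled_back (f', w \<cdot> g') d'"
    using ex_pulled_back push by metis
  have "((f, g), (f', g')) \<in> connected_rel H"
    using pulled_back_push[OF fg(1) d(1)] pulled_back_connected[OF c d]
      pulled_back_push[OF fg(2) d(2)] connected_rel_trans connected_rel_sym by metis
  then show "K = K'" using path_component_eq_iff[OF fg] K by simp
next
  have "K \<in> pi0_push M W X w ` pi0 H" if "K \<in> pi0 H'" for K
  proof -
    obtain c where c: "c \<in> Ob H'" "K = path_component H' c" using \<open>K \<in> pi0 H'\<close> by (rule pi0E)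
    obtain d where d: "pulled_back c d" using ex_pulled_back[OF c(1)] .
    obtain f g where fg: "d = (f, g)" by (cases d)
    have dOb: "(f, g) \<in> Ob H" using pulled_back_Ob(1)[OF c(1) d] fg by simp
    have "pi0_push M W X w (path_component H (f, g)) = K"
      using pi0_push_path_component[OF dOb w] pulled_back_Ob(2)[OF c(1) d] fg c(2)
        path_component_eq_iff[OF push_cocycle_Ob[OF dOb w] c(1)] by simp
    then show ?thesis using path_component_pi0[OF dOb] by blast
  qed
  then show "pi0_push M W X w ` pi0 H = pi0 H'" using pi0_push_in[OF _ w] by blast
qed

end

context closed_model_category
begin

lemma bij_betw_pi0_push:
  assumes proper: "right_proper M W Fib" and prod: "closed_under_finite_products M W"
    and X: "X \<in> Ob M" and w: "w \<in> W" "w \<in> hom M Y Y'"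
  shows "bij_betw (pi0_push M W X w) (pi0 (cocycles M W X Y)) (pi0 (cocycles M W X Y'))"
proof -
  obtain P b a where P: "is_product M Y X P b a"
    using ex_product[OF CM1(1) hom_Ob(1)[OF w(2)] X] .
  obtain Q b' a' where Q: "is_product M Y' X Q b' a'"
    using ex_product[OF CM1(1) hom_Ob(2)[OF w(2)] X] .
  have "a \<in> hom M P X" "b \<in> hom M P Y" using P by (simp_all add: is_product_def)
  then obtain k where k: "k \<in> hom M P Q" "b' \<cdot> k = w \<cdot> b" "a' \<cdot> k = a"
    using product_mapE[OF Q Cmp_hom[OF _ w(2)]] by metis
  \<comment> \<open>This is where closure of weak equivalences under products enters.\<close>
  have "k \<in> W" using prod P Q k w unfolding closed_under_finite_products_def by blast
  then interpret weak_equivalence_product M W Fib Cof X Y Y' P Q w a b a' b' k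
    using proper P Q w(2) k by unfold_locales simp_all
  show ?thesis by (rule bij_betw_pi0_push)
qed

end


section \<open>The inverse of the comparison map\<close>

context category
begin

lemma fraction_hom:
  assumes "f \<in> W" "f \<in> hom C Z X" "g \<in> hom C Z Y"
  shows "fraction C W f g \<in> hom (localization C W) X Y"
  using fraction_eq[OF assms] words_append[OF Bwd_words[OF assms(1,2)] Fwd_words[OF assms(3)]]
  by (simp add: word_class_hom)

lemma cocycle_map_hom:
  assumes "K \<in> pi0 (cocycles C W X Y)"
  shows "cocycle_map C W K \<in> hom (localization C W) X Y"
  using assms
  by (rule pi0_cocyclesE) (simp add: cocycle_map_path_component fraction_hom)

text \<open>Naturality of \<open>\<phi>\<close> in the target, for arrows of \<open>C\<close>:
  associativity in the localization.\<close>

lemma cocycle_map_pi0_push: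
  assumes "K \<in> pi0 (cocycles C W X Y)" and h: "h \<in> hom C Y Z"
  shows "cocycle_map C W (pi0_push C W X h K) =
    loc_map C W h \<cdot>\<^bsub>localization C W\<^esub> cocycle_map C W K"
  using assms(1)
proof (rule pi0_cocyclesE)
  let ?L = "localization C W"
  fix f g
  assume c: "(f, g) \<in> Ob (cocycles C W X Y)"
    and f: "f \<in> W" "f \<in> hom C (Dom C f) X" and g: "g \<in> hom C (Dom C f) Y"
    and K: "K = path_component (cocycles C W X Y) (f, g)"
  have "inverse_arrow ?L (loc_map C W f) \<in> hom ?L X (Dom C f)"
    using inverse_loc_map[OF f] word_class_hom[OF Bwd_words[OF f]] by simp
  then have "fraction C W f (h \<cdot> g) = loc_map C W h \<cdot>\<^bsub>?L\<^esub> fraction C W f g"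
    using category.Cmp_assoc[OF category_localization _ loc_map_hom[OF g] loc_map_hom[OF h]]
    by (simp add: fraction_def loc_map_Cmp[OF g h])
  then show ?thesis
    using pi0_push_path_component[OF c h] cocycle_map_path_component[OF c]
      cocycle_map_path_component[OF push_cocycle_Ob[OF c h]] K by simp
qed

text \<open>A Yoneda argument in an arbitrary category: the component functor extends to the
  localization, where the class of \<open>(1, 1)\<close> is a universal element. The model structure
  enters only through the two kinds of assumption on \<open>W\<close>.\<close>

lemma bij_betw_cocycle_map:
  assumes bij: "\<And>w Y Y'. \<lbrakk>w \<in> W; w \<in> hom C Y Y'\<rbrakk> \<Longrightarrow>
      bij_betw (pi0_push C W X w) (pi0 (cocycles C W X Y)) (pi0 (cocycles C W X Y'))"
    and X: "X \<in> Ob C" "Idt C X \<in> W"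
  shows "bij_betw (cocycle_map C W) (pi0 (cocycles C W X Y)) (hom (localization C W) X Y)"
proof -
  let ?L = "localization C W"
  let ?\<pi> = "\<lambda>Y. pi0 (cocycles C W X Y)"
  interpret L: category ?L by (rule category_localization)
  have "is_iso set_category (pi0_push_arrow C W X w)" if "w \<in> W \<inter> Ar C" for w
  proof -
    have w: "w \<in> W" "w \<in> hom C (Dom C w) (Cod C w)" using that by (simp_all add: hom_def)
    show ?thesis
      unfolding pi0_push_arrow_def
      using pi0_push_in[OF _ w(2)] bij[OF w] by (intro is_iso_set_category) (auto cong: bij_betw_cong)
  qed
  then obtain Gm where G: "is_functor ?L set_category ?\<pi> Gm"
    and Gf: "\<And>f. f \<in> Ar C \<Longrightarrow> Gm (loc_map C W f) = pi0_push_arrow C W X f"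
    using localization_extension[OF category_set_category functor_pi0_push] by metis
  \<comment> \<open>The underlying function of \<open>Gm u\<close>: the action of arrows of the
    localization on components.\<close>
  define act where "act u = fst (snd (Gm u))" for u
  have Gact: "Gm u = (?\<pi> Y, act u, ?\<pi> Z) \<and> act u \<in> ?\<pi> Y \<rightarrow>\<^sub>E ?\<pi> Z" if "u \<in> hom ?L Y Z" for u Y Z
  proof -
    have "Gm u \<in> hom set_category (?\<pi> Y) (?\<pi> Z)"
      using G that unfolding is_functor_def hom_def[of ?L] by blast
    then show ?thesis unfolding set_category_hom act_def by auto
  qed
  have act_in: "act u K \<in> ?\<pi> Z" if "u \<in> hom ?L Y Z" "K \<in> ?\<pi> Y" for u K Y Z
    using Gact[OF that(1)] that(2) by (meson PiE_mem)
  have act_Cmp: "act (v \<cdot>\<^bsub>?L\<^esub> u) K = act v (act u K)"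
    if "u \<in> hom ?L Y Z" "v \<in> hom ?L Z T" "K \<in> ?\<pi> Y" for u v K Y Z T
  proof -
    have "Gm (v \<cdot>\<^bsub>?L\<^esub> u) = Gm v \<cdot>\<^bsub>set_category\<^esub> Gm u"
      using G that(1,2) by (simp add: is_functor_def hom_def[of ?L])
    then show ?thesis
      using Gact[OF that(1)] Gact[OF that(2)] that(3)
      by (simp add: act_def[of "v \<cdot>\<^bsub>?L\<^esub> u"] set_category_Cmp compose_def)
  qed
  have act_Idt: "act (Idt ?L Y) K = K" if "Y \<in> Ob C" "K \<in> ?\<pi> Y" for Y K
  proof -
    have "Gm (Idt ?L Y) = Idt set_category (?\<pi> Y)" using G that(1) unfolding is_functor_def by simp
    then show ?thesis using that(2) by (simp add: act_def set_category_Idt)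
  qed
  have act_loc: "act (loc_map C W f) K = pi0_push C W X f K" if "f \<in> hom C Y Z" "K \<in> ?\<pi> Y" for f Y Z K
    using Gf[OF homD(1)[OF that(1)]] homD(2)[OF that(1)] that(2)
    by (simp add: act_def pi0_push_arrow_def)
  \<comment> \<open>Naturality passes to a formal inverse \<open>i\<close> of \<open>w\<close>: from
    \<open>K = w i K\<close> one gets \<open>\<phi>(K) = w \<phi>(i K)\<close>, and composing with
    \<open>i\<close> gives \<open>i \<phi>(K) = \<phi>(i K)\<close>.\<close>
  have nat_letter: "cocycle_map C W (act (word_class C W Y [s] Z) K) =
      word_class C W Y [s] Z \<cdot>\<^bsub>?L\<^esub> cocycle_map C W K"
    if s: "[s] \<in> words C W Y Z" and K: "K \<in> ?\<pi> Y" for s Y Z K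
  proof (cases s)
    case (Fwd f)
    then have f: "f \<in> hom C Y Z" using s by (auto simp: words_def letters_def hom_def)
    show ?thesis
      using act_loc[OF f K] cocycle_map_pi0_push[OF K f] Fwd by (simp add: loc_map_eq[OF f])
  next
    case (Bwd w)
    then have w: "w \<in> W" "w \<in> hom C Z Y" using s by (auto simp: words_def letters_def hom_def)
    let ?i = "word_class C W Y [s] Z" and ?w = "loc_map C W w"
    have i: "?i \<in> hom ?L Y Z" using word_class_hom[OF s] .
    note wh = loc_map_hom[OF w(2), of W]
    have inv: "?i \<cdot>\<^bsub>?L\<^esub> ?w = Idt ?L Z" "?w \<cdot>\<^bsub>?L\<^esub> ?i = Idt ?L Y"
      using inverse_arrows_loc_map[OF w] Bwd homD[OF wh] by (simp_all add: inverse_arrows_def)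
    note iK = act_in[OF i K]
    have "?w \<cdot>\<^bsub>?L\<^esub> cocycle_map C W (act ?i K) = cocycle_map C W (act ?w (act ?i K))"
      using cocycle_map_pi0_push[OF iK w(2)] act_loc[OF w(2) iK] by simp
    also have "act ?w (act ?i K) = K"
      using act_Cmp[OF i wh K] inv(2) act_Idt[OF hom_Ob(2)[OF w(2)] K] by simp
    finally have "?i \<cdot>\<^bsub>?L\<^esub> cocycle_map C W K = ?i \<cdot>\<^bsub>?L\<^esub> (?w \<cdot>\<^bsub>?L\<^esub> cocycle_map C W (act ?i K))"
      by simp
    also have "\<dots> = cocycle_map C W (act ?i K)"
      using L.Cmp_assoc[OF cocycle_map_hom[OF iK] wh i] L.Idt_left[OF cocycle_map_hom[OF iK]] inv(1)
      by simp
    finally show ?thesis by simp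
  qed
  \<comment> \<open>Letters generate the localization, so naturality holds for all its
    arrows.\<close>
  have nat_word: "cocycle_map C W (act (word_class C W Y u Z) K) =
      word_class C W Y u Z \<cdot>\<^bsub>?L\<^esub> cocycle_map C W K"
    if "u \<in> words C W Y Z" "K \<in> ?\<pi> Y" for u Y Z K
    using that
  proof (induction u arbitrary: Y K)
    case Nil
    then have "Z = Y" "Y \<in> Ob C" by (auto simp: words_def)
    then show ?case
      using act_Idt[of Y K] L.Idt_left[OF cocycle_map_hom[OF Nil(2)]] Nil(2) by (simp add: loc_Idt)
  next
    case (Cons s u)
    define T where "T = letter_tgt C s"
    have u: "u \<in> words C W T Z" using Cons(2) by (simp add: words_def T_def)
    then have s: "[s] \<in> words C W Y T" using Cons(2) words_Ob(1)[OF u]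
      by (simp add: words_def T_def)
    have su: "word_class C W Y (s # u) Z = word_class C W T u Z \<cdot>\<^bsub>?L\<^esub> word_class C W Y [s] T"
      using loc_Cmp[OF s u] by simp
    note sh = word_class_hom[OF s] and uh = word_class_hom[OF u]
    show ?case
      using act_Cmp[OF sh uh Cons(3)] Cons(1)[OF u act_in[OF sh Cons(3)]] nat_letter[OF s Cons(3)]
        L.Cmp_assoc[OF cocycle_map_hom[OF Cons(3)] sh uh] by (simp add: su)
  qed
  let ?I = "Idt C X"
  define unit where "unit = path_component (cocycles C W X X) (?I, ?I)"
  note I = Idt_hom[OF X(1)]
  have II: "(?I, ?I) \<in> Ob (cocycles C W X X)" using X(2) I homD(2)[OF I] by (simp add: cocycle_Ob)
  then have unit: "unit \<in> ?\<pi> X" unfolding unit_def by (rule path_component_pi0)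
  have "cocycle_map C W unit = Idt ?L X"
  proof -
    have "inverse_arrows ?L (Idt ?L X) (Idt ?L X)"
      using L.Idt_hom[of X] L.Idt_left[OF L.Idt_hom[of X]] X(1) by (simp add: inverse_arrows_def hom_def)
    then have "inverse_arrow ?L (Idt ?L X) = Idt ?L X" by (rule L.inverse_arrow_eq)
    then show ?thesis
      using L.Idt_left[OF L.Idt_hom[of X]] X(1)
      by (simp add: unit_def cocycle_map_path_component[OF II] fraction_def loc_map_Idt)
  qed
  \<comment> \<open>Naturality at \<open>unit\<close>:
    \<open>\<phi>(u unit) = u \<phi>(unit) = u\<close>.\<close>
  then have right: "cocycle_map C W (act u unit) = u" if "u \<in> hom ?L X Y" for u
    using that nat_word[OF _ unit] L.Idt_right[OF that] by (elim loc_homE) simp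
  have left: "act (cocycle_map C W K) unit = K" if "K \<in> ?\<pi> Y" for K
    using that
  proof (rule pi0_cocyclesE)
    fix f g
    assume c: "(f, g) \<in> Ob (cocycles C W X Y)"
      and f: "f \<in> W" "f \<in> hom C (Dom C f) X" and g: "g \<in> hom C (Dom C f) Y"
      and K: "K = path_component (cocycles C W X Y) (f, g)"
    define Z where "Z = Dom C f"
    have f: "f \<in> W" "f \<in> hom C Z X" and g: "g \<in> hom C Z Y" using f g by (simp_all add: Z_def)
    let ?f = "loc_map C W f" and ?i = "inverse_arrow ?L (loc_map C W f)"
    have Z: "Idt C Z \<in> hom C Z Z" using Idt_hom hom_Ob(1)[OF f(2)] .
    \<comment> \<open>The class of \<open>(f, 1)\<close> over \<open>Z\<close> links
      \<open>unit\<close> with \<open>K\<close>: pushing it along \<open>f\<close> gives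
      \<open>unit\<close>, pushing it along \<open>g\<close> gives \<open>K\<close>. Hence the
      fraction of \<open>f\<close> and \<open>g\<close> carries \<open>unit\<close> to
      \<open>K\<close>.\<close>
    have fi: "(f, Idt C Z) \<in> Ob (cocycles C W X Z)" using f Z by (simp add: cocycle_Ob Z_def)
    let ?K = "path_component (cocycles C W X Z) (f, Idt C Z)"
    have KZ: "?K \<in> ?\<pi> Z" using path_component_pi0[OF fi] .
    have ff: "(f, f) \<in> Ob (cocycles C W X X)"
      using push_cocycle_Ob[OF fi f(2)] Idt_right[OF f(2)] by simp
    have "((f, f), (?I, ?I)) \<in> connected_rel (cocycles C W X X)"
      using f(2) homD(2)[OF f(2)] homD(2)[OF I] Idt_left[OF f(2)]
      by (intro connected_cocyclesI[OF ff II, of f]) simp_all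
    then have "act ?f ?K = unit"
      using act_loc[OF f(2) KZ] pi0_push_path_component[OF fi f(2)] Idt_right[OF f(2)]
        path_component_eq_iff[OF ff II] by (simp add: unit_def)
    moreover have i: "?i \<in> hom ?L X Z" "?i \<cdot>\<^bsub>?L\<^esub> ?f = Idt ?L Z"
      using inverse_arrows_loc_map[OF f] inverse_loc_map[OF f] homD[OF loc_map_hom[OF f(2)]]
      by (simp_all add: inverse_arrows_def)
    ultimately have "act ?i unit = ?K"
      using act_Cmp[OF loc_map_hom[OF f(2)] i(1) KZ] act_Idt[OF hom_Ob(1)[OF f(2)] KZ] by simp
    moreover have "act (loc_map C W g) ?K = K"
      using act_loc[OF g KZ] pi0_push_path_component[OF fi g] Idt_right[OF g] K by simp
    ultimately show ?thesis
      using act_Cmp[OF i(1) loc_map_hom[OF g] unit]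
      by (simp add: K cocycle_map_path_component[OF c] fraction_def)
  qed
  show ?thesis
    by (rule bij_betw_byWitness[where f' = "\<lambda>u. act u unit"])
      (use left right cocycle_map_hom act_in[OF _ unit] in auto)
qed

end

text \<open>As \<open>cocycle_map\<close> is defined through \<open>the_elem\<close>, the first
  conjunct certifies that its value is the common fraction of all members of a component; the
  bijection in the second is therefore \<open>\<phi>\<close>.\<close>

theorem theorem2:
  fixes M :: "('o, 'm) category"
    and W Fib Cof :: "'m set"
    and X Y :: 'o
  assumes "closed_model_category M W Fib Cof"
    and "right_proper M W Fib"
    and "closed_under_finite_products M W"
    and "X \<in> Ob M" and "Y \<in> Ob M"
  shows "(\<forall>(f, g) \<in> Ob (cocycles M W X Y).
            cocycle_map M W (path_component (cocycles M W X Y) (f, g)) = fraction M W f g)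
       \<and> bij_betw (cocycle_map M W) (pi0 (cocycles M W X Y)) (hom (localization M W) X Y)"
proof -
  interpret closed_model_category M W Fib Cof by (rule assms(1))
  show ?thesis
    using cocycle_map_path_component bij_betw_cocycle_map[OF bij_betw_pi0_push[OF assms(2,3,4)]
        assms(4) Idt_W[OF assms(4)]] by auto
qed

end
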